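(* Let $Q_0:\mathbb{R}^3\to\mathrm{sym}_0(3)$ be smooth, and let $\widehat\gamma_{0i}:\mathbb{R}^3\to\mathfrak{so}(3)$ $(i=1,2,3)$ be smooth with $\partial_iQ_0=[Q_0,\widehat\gamma_{0i}]$. Let $R:\mathbb{R}^3\times[t_1,t_2]\to\mathrm{SO}(3)$ be smooth and put $$Q=RQ_0R^{T},\qquad \widehat\nu=(\partial_tR)R^{-1},\qquad \widehat\gamma_i=-(\partial_iR)R^{-1}+R\,\widehat\gamma_{0i}R^{-1}.$$ Then $\partial_iQ=[Q,\widehat\gamma_i]$, $$\partial_tQ=[\widehat\nu,Q],\qquad \partial_t\widehat\gamma_i=[\widehat\nu,\widehat\gamma_i]-\partial_i\widehat\nu,$$ and, with $\Psi(Q,\widehat\gamma):=\mathcal F(Q,[Q,\widehat\gamma])$, the variational principle $$\delta\int_{t_1}^{t_2}\!\!\int\Big(\frac J2\|[\widehat\nu,Q]\|^2-\Psi(Q,\widehat\gamma)\Big)\,\mathrm d^3x\,\mathrm dt=0$$ with variations $\delta\widehat\nu=\partial_t\widehat\eta+[\widehat\eta,\widehat\nu]$, $\delta Q=[\widehat\eta,Q]$, $\delta\widehat\gamma_i=[\widehat\eta,\widehat\gamma_i]-\partial_i\widehat\eta$ ($\widehat\eta=(\delta R)R^{-1}$ arbitrary) holds if and only if $$J\frac{\partial}{\partial t}\big[[\widehat\nu,Q],Q\big]=\Big[Q,\frac{\partial\Psi}{\partial Q}\Big]+\Big[\frac{\partial\Psi}{\partial\widehat\gamma_i},\widehat\g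amma_i\Big]-\partial_i\frac{\partial\Psi}{\partial\widehat\gamma_i}.$$
   Context: $\mathrm{sym}_0(3)$ is the space of real symmetric traceless $3\times3$ matrices and $\mathfrak{so}(3)$ the space of real antisymmetric $3\times 3$ matrices; $[A,B]=AB-BA$; $\|A\|^2=\operatorname{Tr}(A^TA)$; $J>0$ is a constant. Repeated indices are summed. $\mathcal F(Q,\nabla Q)$ is the Landau--de Gennes free energy $$\mathcal F=\tfrac12\big(\alpha Q_{ij}Q_{ij}+L_1Q_{ij,k}Q_{ij,k}+L_2Q_{ij,j}Q_{ik,k}\big)+\tfrac{4\pi}{P}L_1\varepsilon_{ijk}Q_{il}Q_{kl,j}-\beta Q_{ij}Q_{jk}Q_{ki}+\gamma(Q_{ij}Q_{ij})^2$$ with $Q_{ij,k}=\partial_kQ_{ij}$ and real constants $\alpha,L_1,L_2,\beta,\gamma$, $P\ne0$ (the constant $\gamma$ is unrelated to $\widehat\gamma_i$). $\mathcal F(Q,[Q,\widehat\gamma])$ means that $\partial_kQ$ is replaced by $[Q,\widehat\gamma_k]$. Matrix derivatives are gradients with respect to the pairing $\langle A,B\rangle=\operatorname{Tr}(A^TB)$: $\partial\Psi/\partial Q$ is the symmetric matrix, and $\partial\Psi/\partial\widehat\gamma_i$ the antisymmetric matrix, with $\delta\Psi=\langle\partial\Psi/\partial Q,\delta Q\rangle+\langle\partial\Psi/\partial\widehat\gamma_i,\delta\widehat\gamma_i\rangle$ for all symmetric $\delta Q$ and antisymmetric $\delta\widehat\gamma_i$. Meaning of the variational principle: the first variation of the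 integral, i.e. the integral of the linearization of the integrand in the direction of the stated variations, vanishes for every smooth $\mathfrak{so}(3)$-valued $\widehat\eta$ with compact support in $\mathbb{R}^3\times(t_1,t_2)$. *)

theory Defs
  imports "HOL-Analysis.Analysis"
begin

type_synonym mat3 = "real^3^3"
type_synonym mat3_triple = "mat3^3"

definition sym3 :: "mat3 set" where
  "sym3 = {A. transpose A = A}"

definition sym0_3 :: "mat3 set" where
  "sym0_3 = {A. transpose A = A \<and> trace A = 0}"

definition so3 :: "mat3 set" where
  "so3 = {A. transpose A = - A}"

definition commutator :: "mat3 \<Rightarrow> mat3 \<Rightarrow> mat3" where
  "commutator A B = A ** B - B ** A"

definition pairing :: "mat3 \<Rightarrow> mat3 \<Rightarrow> real" where
  "pairing A B = trace (transpose A ** B)"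

text \<open>
  \<open>C\<^sup>k\<close> on a set, with derivatives taken within the set. This is meant for sets on which
  the derivative within the set is unique, such as the whole space and the closed slab
  \<open>\<real>\<^sup>3 \<times> [t1, t2]\<close> with \<open>t1 < t2\<close>; on the slab all derivatives are
  thus required to be continuous up to the boundary (one-sided in time there).
\<close>

fun Ck_on :: "nat \<Rightarrow> ('a::euclidean_space \<Rightarrow> 'b::euclidean_space) \<Rightarrow> 'a set \<Rightarrow> bool" where
  "Ck_on 0 f S \<longleftrightarrow> continuous_on S f"
| "Ck_on (Suc k) f S \<longleftrightarrow>
     (\<exists>f'. (\<forall>x\<in>S. (f has_derivative f' x) (at x within S)) \<and>
           (\<forall>v. Ck_on k (\<lambda>x. f' x v) S))"

definition smooth_on :: "('a::euclidean_space \<Rightarrow> 'b::euclidean_space) \<Rightarrow> 'a set \<Rightarrow> bool" where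
  "smooth_on f S \<longleftrightarrow> (\<forall>k. Ck_on k f S)"

definition partial :: "3 \<Rightarrow> (real^3 \<Rightarrow> 'b::real_normed_vector) \<Rightarrow> real^3 \<Rightarrow> 'b" where
  "partial i f x = vector_derivative (\<lambda>s. f (x + s *\<^sub>R axis i 1)) (at 0)"

definition time_deriv :: "real \<Rightarrow> real \<Rightarrow> (real \<Rightarrow> 'b::real_normed_vector) \<Rightarrow> real \<Rightarrow> 'b" where
  "time_deriv t1 t2 f t = vector_derivative f (at t within {t1..t2})"

definition levi_civita :: "3 \<Rightarrow> 3 \<Rightarrow> 3 \<Rightarrow> real" where
  "levi_civita i j k =
     (if (i, j, k) \<in> {(1, 2, 3), (2, 3, 1), (3, 1, 2)} then 1
      else if (i, j, k) \<in> {(1, 3, 2), (3, 2, 1), (2, 1, 3)} then - 1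
      else 0)"

text \<open>
  The Landau--de Gennes energy density as a function of \<open>Q\<close> and of the array
  \<open>D\<close> with \<open>D $ k = \<partial>\<^sub>k Q\<close>, so that \<open>Q\<^sub>i\<^sub>j\<^sub>,\<^sub>k\<close> is \<open>D $ k $ i $ j\<close>.
\<close>

definition landau_de_gennes ::
  "real \<Rightarrow> real \<Rightarrow> real \<Rightarrow> real \<Rightarrow> real \<Rightarrow> real \<Rightarrow> mat3 \<Rightarrow> mat3_triple \<Rightarrow> real" where
  "landau_de_gennes \<alpha> L1 L2 \<beta> c P Q D =
     1/2 * (\<alpha> * (\<Sum>i\<in>UNIV. \<Sum>j\<in>UNIV. Q $ i $ j * Q $ i $ j)
          + L1 * (\<Sum>i\<in>UNIV. \<Sum>j\<in>UNIV. \<Sum>k\<in>UNIV. D $ k $ i $ j * D $ k $ i $ j)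
          + L2 * (\<Sum>i\<in>UNIV. \<Sum>j\<in>UNIV. \<Sum>k\<in>UNIV. D $ j $ i $ j * D $ k $ i $ k))
     + 4 * pi / P * L1 *
         (\<Sum>i\<in>UNIV. \<Sum>j\<in>UNIV. \<Sum>k\<in>UNIV. \<Sum>l\<in>UNIV.
            levi_civita i j k * Q $ i $ l * D $ j $ k $ l)
     - \<beta> * (\<Sum>i\<in>UNIV. \<Sum>j\<in>UNIV. \<Sum>k\<in>UNIV. Q $ i $ j * Q $ j $ k * Q $ k $ i)
     + c * (\<Sum>i\<in>UNIV. \<Sum>j\<in>UNIV. Q $ i $ j * Q $ i $ j)\<^sup>2"

text \<open>
  The gradients of \<open>\<Psi>\<close> with respect to the pairing: the symmetric matrix and the three
  antisymmetric matrices that represent the derivative of \<open>\<Psi>\<close> in all symmetric directions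
  \<open>\<delta>Q\<close> and antisymmetric directions \<open>\<delta>\<gamma>\<^sub>i\<close>.
\<close>

definition is_gradient :: "(mat3 \<Rightarrow> mat3_triple \<Rightarrow> real) \<Rightarrow> mat3 \<Rightarrow> mat3_triple \<Rightarrow> mat3 \<times> mat3_triple \<Rightarrow> bool" where
  "is_gradient \<Psi> Q \<gamma> = (\<lambda>(S, G).
     S \<in> sym3 \<and> (\<forall>i. G $ i \<in> so3) \<and>
     (\<forall>dQ d\<gamma>. dQ \<in> sym3 \<longrightarrow> (\<forall>i. d\<gamma> $ i \<in> so3) \<longrightarrow>
        frechet_derivative (\<lambda>(q, g). \<Psi> q g) (at (Q, \<gamma>)) (dQ, d\<gamma>)
          = pairing S dQ + (\<Sum>i\<in>UNIV. pairing (G $ i) (d\<gamma> $ i))))"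

definition grad_Q :: "(mat3 \<Rightarrow> mat3_triple \<Rightarrow> real) \<Rightarrow> mat3 \<Rightarrow> mat3_triple \<Rightarrow> mat3" where
  "grad_Q \<Psi> Q \<gamma> = fst (THE SG. is_gradient \<Psi> Q \<gamma> SG)"

definition grad_\<gamma> :: "(mat3 \<Rightarrow> mat3_triple \<Rightarrow> real) \<Rightarrow> mat3 \<Rightarrow> mat3_triple \<Rightarrow> 3 \<Rightarrow> mat3" where
  "grad_\<gamma> \<Psi> Q \<gamma> i = snd (THE SG. is_gradient \<Psi> Q \<gamma> SG) $ i"

definition lagrangian :: "real \<Rightarrow> (mat3 \<Rightarrow> mat3_triple \<Rightarrow> real) \<Rightarrow> mat3 \<times> mat3 \<times> mat3_triple \<Rightarrow> real" where
  "lagrangian J \<Psi> = (\<lambda>(\<nu>, Q, \<gamma>).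
     J / 2 * pairing (commutator \<nu> Q) (commutator \<nu> Q) - \<Psi> Q \<gamma>)"

definition first_variation ::
  "real \<Rightarrow> (mat3 \<Rightarrow> mat3_triple \<Rightarrow> real) \<Rightarrow> real \<Rightarrow> real \<Rightarrow>
   (real^3 \<Rightarrow> real \<Rightarrow> mat3) \<Rightarrow> (real^3 \<Rightarrow> real \<Rightarrow> mat3) \<Rightarrow> (real^3 \<Rightarrow> real \<Rightarrow> mat3_triple) \<Rightarrow>
   (real^3 \<Rightarrow> real \<Rightarrow> mat3) \<Rightarrow> real" where
  "first_variation J \<Psi> t1 t2 \<nu> Q \<gamma> \<eta> =
     (LINT t:{t1..t2}|lborel. LINT x|lborel.
        frechet_derivative (lagrangian J \<Psi>) (at (\<nu> x t, Q x t, \<gamma> x t))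
          (time_deriv t1 t2 (\<eta> x) t + commutator (\<eta> x t) (\<nu> x t),
           commutator (\<eta> x t) (Q x t),
           \<chi> i. commutator (\<eta> x t) (\<gamma> x t $ i) - partial i (\<lambda>y. \<eta> y t) x))"

definition admissible_variation :: "real \<Rightarrow> real \<Rightarrow> (real^3 \<Rightarrow> real \<Rightarrow> mat3) \<Rightarrow> bool" where
  "admissible_variation t1 t2 \<eta> \<longleftrightarrow>
     smooth_on (\<lambda>(x, t). \<eta> x t) UNIV \<and>
     (\<forall>x t. \<eta> x t \<in> so3) \<and>
     compact (closure {(x, t). \<eta> x t \<noteq> 0}) \<and>
     closure {(x, t). \<eta> x t \<noteq> 0} \<subseteq> UNIV \<times> {t1<..<t2}"

end

(*
  The moving-frame identities are the product rule applied to R R^T = 1; the compatibility of the time and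
  space derivatives also needs that mixed derivatives of R commute up to the boundary of the slab.

  For the variational principle, invariance of the inner product under commutators (with signs for symmetric
  and antisymmetric factors) writes the integrand as J p . d_t eta + N . eta + G_i . d_i eta, where
  p = [[nu,Q],Q], G_i is the gradient in gamma_i and N collects the commutators on the right-hand side.
  Integration by parts turns the first variation into the integral of E . eta with
  E = N - J d_t p - d_i G_i. Since E is so(3)-valued, eta = phi E(z0) with a bump function phi is admissible
  and forces E(z0) = 0 in the open slab; continuity gives E = 0 up to t = t1, t2.
*)

theory Submission
  imports Defs
begin

subsection \<open>Calculus of \<open>C\<^sup>k\<close> maps\<close>

text \<open>Two features of the setting shape the proof. The fields are controlled only on the
  closed slab, with one-sided time derivatives at \<open>t1\<close> and \<open>t2\<close>, whereas
  integrals over space-time run over the whole space. Every global integrand is therefore cut off by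
  the indicator of a compact set inside the open slab. Integration by parts then reduces to one fact
  on the whole space, that a directional derivative of a compactly supported function has integral
  \<open>0\<close>, which comes from translation invariance of Lebesgue measure. Time and space
  directions are both vectors of the product space, so one statement covers them. The gradients of
  \<open>\<Psi>\<close> are given by a definite description. They are evaluated as Riesz
  representatives projected to symmetric or antisymmetric matrices. The explicit formula makes them
  smooth along the fields, and this makes \<open>\<partial>\<^sub>i\<close> of the gradient, and
  with it \<open>E\<close>, continuous. The symmetry types matter for signs: moving
  \<open>\<eta>\<close> out of a commutator keeps the sign for a symmetric partner and flips it for
  an antisymmetric one.\<close>

lemma Ck_on_SucE:
  assumes "Ck_on (Suc k) f S"
  obtains f' where "\<And>x. x \<in> S \<Longrightarrow> (f has_derivative f' x) (at x within S)"
    "\<And>v. Ck_on k (\<lambda>x. f' x v) S"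
  using assms by auto

lemma Ck_on_SucI:
  assumes "\<And>x. x \<in> S \<Longrightarrow> (f has_derivative f' x) (at x within S)"
    "\<And>v. Ck_on k (\<lambda>x. f' x v) S"
  shows "Ck_on (Suc k) f S"
  using assms by auto

text \<open>Derivatives are taken within \<open>S\<close>, so values off \<open>S\<close> do not
  matter. This carries formulas that hold only for times in \<open>{t1..t2}\<close> over to
  smoothness on the slab.\<close>

lemma Ck_on_cong:
  assumes "Ck_on k f S" "\<And>x. x \<in> S \<Longrightarrow> g x = f x"
  shows "Ck_on k g S"
proof (cases k)
  case 0
  then show ?thesis using assms continuous_on_cong by (metis Ck_on.simps(1))
next
  case (Suc m)
  obtain f' where "\<And>x. x \<in> S \<Longrightarrow> (f has_derivative f' x) (at x within S)"
    "\<And>v. Ck_on m (\<lambda>x. f' x v) S"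
    using Ck_on_SucE assms(1) Suc by metis
  then show ?thesis unfolding Suc
    using assms(2) by (intro Ck_on_SucI) (blast intro: has_derivative_transform)+
qed

lemma Ck_on_SucD: "Ck_on (Suc k) f S \<Longrightarrow> Ck_on k f S"
proof (induction k arbitrary: f)
  case 0
  then show ?case unfolding Ck_on.simps(1)
    by (elim Ck_on_SucE) (rule has_derivative_continuous_on)
next
  case (Suc k)
  obtain f' where f': "\<And>x. x \<in> S \<Longrightarrow> (f has_derivative f' x) (at x within S)"
    "\<And>v. Ck_on (Suc k) (\<lambda>x. f' x v) S" using Suc.prems Ck_on_SucE by blast
  show ?case
    by (rule Ck_on_SucI[OF f'(1) Suc.IH[OF f'(2)]])
qed

lemma Ck_on_subset: "Ck_on k f S \<Longrightarrow> T \<subseteq> S \<Longrightarrow> Ck_on k f T"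
proof (induction k arbitrary: f)
  case 0
  then show ?case by (auto intro: continuous_on_subset)
next
  case (Suc k)
  obtain f' where f': "\<And>x. x \<in> S \<Longrightarrow> (f has_derivative f' x) (at x within S)"
    "\<And>v. Ck_on k (\<lambda>x. f' x v) S" using Suc.prems(1) Ck_on_SucE by blast
  show ?case
    by (rule Ck_on_SucI[OF has_derivative_subset[OF f'(1)] Suc.IH[OF f'(2)]]) (use Suc.prems(2) in auto)
qed

lemma Ck_on_const: "Ck_on k (\<lambda>_. c) S"
proof (induction k arbitrary: c)
  case 0
  then show ?case by simp
next
  case (Suc k)
  then show ?case
    by (intro Ck_on_SucI[where f' = "\<lambda>_ _. 0"] has_derivative_const)
qed

lemma Ck_on_ident: "Ck_on k (\<lambda>x. x) S"
proof (cases k)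
  case 0
  then show ?thesis by simp
next
  case (Suc m)
  show ?thesis
    unfolding Suc by (rule Ck_on_SucI[OF has_derivative_ident Ck_on_const])
qed

lemma Ck_on_bounded_linear:
  assumes "bounded_linear h"
  shows "Ck_on k f S \<Longrightarrow> Ck_on k (\<lambda>x. h (f x)) S"
proof (induction k arbitrary: f)
  case 0
  then show ?case using assms
    by (auto intro: bounded_linear.continuous_on)
next
  case (Suc k)
  obtain f' where f': "\<And>x. x \<in> S \<Longrightarrow> (f has_derivative f' x) (at x within S)"
    "\<And>v. Ck_on k (\<lambda>x. f' x v) S" using Suc.prems Ck_on_SucE by blast
  show ?case
    by (rule Ck_on_SucI[OF bounded_linear.has_derivative[OF assms f'(1)] Suc.IH[OF f'(2)]])
qed

lemma Ck_on_add: "Ck_on k f S \<Longrightarrow> Ck_on k g S \<Longrightarrow> Ck_on k (\<lambda>x. f x + g x) S"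
proof (induction k arbitrary: f g)
  case 0
  then show ?case by (auto intro: continuous_on_add)
next
  case (Suc k)
  obtain f' where f': "\<And>x. x \<in> S \<Longrightarrow> (f has_derivative f' x) (at x within S)"
    "\<And>v. Ck_on k (\<lambda>x. f' x v) S" using Suc.prems(1) Ck_on_SucE by blast
  obtain g' where g': "\<And>x. x \<in> S \<Longrightarrow> (g has_derivative g' x) (at x within S)"
    "\<And>v. Ck_on k (\<lambda>x. g' x v) S" using Suc.prems(2) Ck_on_SucE by blast
  show ?case
    by (rule Ck_on_SucI[OF has_derivative_add[OF f'(1) g'(1)] Suc.IH[OF f'(2) g'(2)]])
qed

lemma Ck_on_sum:
  assumes "\<And>i. i \<in> I \<Longrightarrow> Ck_on k (f i) S"
  shows "Ck_on k (\<lambda>x. \<Sum>i\<in>I. f i x) S"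
  using assms
  by (induction I rule: infinite_finite_induct) (simp_all add: Ck_on_add Ck_on_const)

lemma Ck_on_bilinear:
  assumes "bounded_bilinear p"
  shows "Ck_on k f S \<Longrightarrow> Ck_on k g S \<Longrightarrow> Ck_on k (\<lambda>x. p (f x) (g x)) S"
proof (induction k arbitrary: f g)
  case 0
  then show ?case using assms by (auto intro: bounded_bilinear.continuous_on)
next
  case (Suc k)
  obtain f' where f': "\<And>x. x \<in> S \<Longrightarrow> (f has_derivative f' x) (at x within S)"
    "\<And>v. Ck_on k (\<lambda>x. f' x v) S" using Suc.prems(1) Ck_on_SucE by blast
  obtain g' where g': "\<And>x. x \<in> S \<Longrightarrow> (g has_derivative g' x) (at x within S)"
    "\<And>v. Ck_on k (\<lambda>x. g' x v) S" using Suc.prems(2) Ck_on_SucE by blast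
  \<comment> \<open>Each term of the product rule keeps one undifferentiated factor, so the
    induction hypothesis needs \<open>f\<close> and \<open>g\<close> themselves at order
    \<open>k\<close>.\<close>
  have "Ck_on k f S" "Ck_on k g S" using Suc.prems Ck_on_SucD by blast+
  then show ?case
    by (intro Ck_on_SucI[OF bounded_bilinear.FDERIV[OF assms f'(1) g'(1)]]
        Ck_on_add[OF Suc.IH Suc.IH] f'(2) g'(2))
qed

lemma Ck_on_compose:
  assumes "Ck_on k f UNIV" "Ck_on k g S"
  shows "Ck_on k (\<lambda>x. f (g x)) S"
  using assms
proof (induction k arbitrary: f g)
  case 0
  then show ?case by (auto intro: continuous_on_compose2)
next
  case (Suc k)
  obtain f' where f': "\<And>x. (f has_derivative f' x) (at x)" "\<And>v. Ck_on k (\<lambda>x. f' x v) UNIV"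
    using Suc.prems(1) Ck_on_SucE by (metis UNIV_I)
  obtain g' where g': "\<And>x. x \<in> S \<Longrightarrow> (g has_derivative g' x) (at x within S)"
    "\<And>v. Ck_on k (\<lambda>x. g' x v) S" using Suc.prems(2) Ck_on_SucE by blast
  have g: "Ck_on k g S" using Suc.prems Ck_on_SucD by blast
  have "((\<lambda>x. f (g x)) has_derivative (\<lambda>v. f' (g x) (g' x v))) (at x within S)" if "x \<in> S" for x
    using has_derivative_compose[OF g'(1)[OF that] f'(1)] .
  moreover have "Ck_on k (\<lambda>x. f' (g x) (g' x v)) S" for v
  proof (rule Ck_on_cong)
    \<comment> \<open>The chain rule evaluates \<open>f' (g x)\<close> in the direction
      \<open>g' x v\<close>, which moves with \<open>x\<close>, while the induction hypothesis
      speaks of fixed directions only. Expanding the direction in the basis leaves fixed directions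
      with scalar coefficients.\<close>
    show "Ck_on k (\<lambda>x. \<Sum>b\<in>Basis. (g' x v \<bullet> b) *\<^sub>R f' (g x) b) S"
      by (intro Ck_on_sum Ck_on_bilinear[OF bounded_bilinear_scaleR]
          Ck_on_bilinear[OF bounded_bilinear_inner] Suc.IH Ck_on_const f'(2) g'(2) g)
    fix x
    have "linear (f' (g x))" using f'(1) has_derivative_linear by blast
    then have "f' (g x) (\<Sum>b\<in>Basis. (g' x v \<bullet> b) *\<^sub>R b) = (\<Sum>b\<in>Basis. (g' x v \<bullet> b) *\<^sub>R f' (g x) b)"
      by (simp add: linear_sum linear_scale)
    then show "f' (g x) (g' x v) = (\<Sum>b\<in>Basis. (g' x v \<bullet> b) *\<^sub>R f' (g x) b)"
      by (simp only: euclidean_representation)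
  qed
  ultimately show ?case by (rule Ck_on_SucI)
qed

lemma smooth_on_cong:
  "smooth_on f S \<Longrightarrow> (\<And>x. x \<in> S \<Longrightarrow> g x = f x) \<Longrightarrow> smooth_on g S"
  by (auto simp: smooth_on_def intro: Ck_on_cong)

lemma smooth_on_subset: "smooth_on f S \<Longrightarrow> T \<subseteq> S \<Longrightarrow> smooth_on f T"
  by (auto simp: smooth_on_def intro: Ck_on_subset)

lemma smooth_on_const: "smooth_on (\<lambda>_. c) S"
  by (simp add: smooth_on_def Ck_on_const)

lemma smooth_on_ident: "smooth_on (\<lambda>x. x) S"
  by (simp add: smooth_on_def Ck_on_ident)

lemma smooth_on_bounded_linear:
  "bounded_linear h \<Longrightarrow> smooth_on f S \<Longrightarrow> smooth_on (\<lambda>x. h (f x)) S"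
  by (simp add: smooth_on_def Ck_on_bounded_linear)

lemma smooth_on_bilinear:
  "bounded_bilinear p \<Longrightarrow> smooth_on f S \<Longrightarrow> smooth_on g S \<Longrightarrow> smooth_on (\<lambda>x. p (f x) (g x)) S"
  by (simp add: smooth_on_def Ck_on_bilinear)

lemma smooth_on_compose:
  "smooth_on f UNIV \<Longrightarrow> smooth_on g S \<Longrightarrow> smooth_on (\<lambda>x. f (g x)) S"
  by (simp add: smooth_on_def Ck_on_compose)

lemma smooth_on_add: "smooth_on f S \<Longrightarrow> smooth_on g S \<Longrightarrow> smooth_on (\<lambda>x. f x + g x) S"
  by (simp add: smooth_on_def Ck_on_add)

lemma smooth_on_sum: "(\<And>i. i \<in> I \<Longrightarrow> smooth_on (f i) S) \<Longrightarrow> smooth_on (\<lambda>x. \<Sum>i\<in>I. f i x) S"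
  by (simp add: smooth_on_def Ck_on_sum)

lemma smooth_on_minus: "smooth_on f S \<Longrightarrow> smooth_on (\<lambda>x. - f x) S"
  by (rule smooth_on_bounded_linear[OF bounded_linear_minus[OF bounded_linear_ident]])

lemma smooth_on_diff: "smooth_on f S \<Longrightarrow> smooth_on g S \<Longrightarrow> smooth_on (\<lambda>x. f x - g x) S"
  using smooth_on_add[OF _ smooth_on_minus, of f S g] by simp

lemmas smooth_on_scaleR = smooth_on_bilinear[OF bounded_bilinear_scaleR]
lemmas smooth_on_inner = smooth_on_bilinear[OF bounded_bilinear_inner]
lemmas smooth_on_mult = smooth_on_bilinear[OF bounded_bilinear_mult]
lemmas smooth_on_fst = smooth_on_bounded_linear[OF bounded_linear_fst]
lemmas smooth_on_snd = smooth_on_bounded_linear[OF bounded_linear_snd]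
lemmas smooth_on_vec_nth = smooth_on_bounded_linear[OF bounded_linear_vec_nth]

lemma smooth_on_Pair:
  fixes f :: "'a::euclidean_space \<Rightarrow> 'b::euclidean_space" and g :: "'a \<Rightarrow> 'c::euclidean_space"
  assumes "smooth_on f S" "smooth_on g S"
  shows "smooth_on (\<lambda>x. (f x, g x)) S"
proof -
  have "smooth_on (\<lambda>x. (f x, 0::'c) + (0::'b, g x)) S"
    by (intro smooth_on_add smooth_on_bounded_linear[OF _ assms(1)]
        smooth_on_bounded_linear[OF _ assms(2)] bounded_linear_Pair bounded_linear_ident bounded_linear_zero)
  then show ?thesis by simp
qed

lemma smooth_on_vec_lambda:
  fixes f :: "'i::finite \<Rightarrow> 'a::euclidean_space \<Rightarrow> 'b::euclidean_space"
  assumes "\<And>i. smooth_on (f i) S"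
  shows "smooth_on (\<lambda>x. \<chi> i. f i x) S"
proof -
  have bl: "bounded_linear (\<lambda>y::'b. axis i y)" for i :: 'i
    by (auto intro!: linear_conv_bounded_linear[THEN iffD1] linearI simp: vec_eq_iff axis_def)
  have "smooth_on (\<lambda>x. \<Sum>i\<in>UNIV. axis i (f i x)) S"
    by (intro smooth_on_sum smooth_on_bounded_linear[OF bl assms])
  moreover have "(\<Sum>i\<in>UNIV. axis i (f i x)) = (\<chi> i. f i x)" for x
    by (simp add: vec_eq_iff axis_def sum.delta')
  ultimately show ?thesis by simp
qed

lemma smooth_on_imp_continuous_on: "smooth_on f S \<Longrightarrow> continuous_on S f"
  unfolding smooth_on_def using Ck_on.simps(1) by blast

lemma smooth_onD:
  assumes "smooth_on f S"
  obtains f' where "\<And>x. x \<in> S \<Longrightarrow> (f has_derivative f' x) (at x within S)"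
    "\<And>v. continuous_on S (\<lambda>x. f' x v)"
proof -
  have "Ck_on (Suc 0) f S" using assms unfolding smooth_on_def by blast
  then show thesis using that Ck_on_SucE Ck_on.simps(1) by metis
qed

text \<open>The definition allows a different derivative witness for each order. On the whole space
  derivatives are unique, so all of these witnesses are the one
  \<open>frechet_derivative\<close>.\<close>

lemma smooth_on_frechet_derivative:
  assumes "smooth_on f UNIV"
  shows "smooth_on (\<lambda>x. frechet_derivative f (at x) v) UNIV"
  unfolding smooth_on_def
proof
  fix k
  have "Ck_on (Suc k) f UNIV" using assms unfolding smooth_on_def by blast
  then obtain f' where "\<And>x. (f has_derivative f' x) (at x)" "\<And>v. Ck_on k (\<lambda>x. f' x v) UNIV"
    using Ck_on_SucE by (metis UNIV_I)
  then show "Ck_on k (\<lambda>x. frechet_derivative f (at x) v) UNIV"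
    using frechet_derivative_at by (metis (no_types, lifting) Ck_on_cong)
qed

subsection \<open>A smooth bump function\<close>

text \<open>
  The class of functions \<open>p(1/x) exp(-1/x)\<close> on \<open>x > 0\<close>, extended by \<open>0\<close>, with \<open>p\<close> a polynomial,
  is closed under differentiation: with \<open>u = 1/x\<close> the polynomial \<open>p\<close> becomes \<open>u\<^sup>2 (p - p')\<close>.
\<close>

definition flat_exp :: "real poly \<Rightarrow> real \<Rightarrow> real" where
  "flat_exp p x = (if x > 0 then poly p (1 / x) * exp (- (1 / x)) else 0)"

lemma poly_div_exp_tendsto_0: "((\<lambda>x. poly p x * exp (- x)) \<longlongrightarrow> (0::real)) at_top"
proof -
  have "((\<lambda>x. \<Sum>i\<le>degree p. coeff p i * (x ^ i / exp x)) \<longlongrightarrow> (\<Sum>i\<le>degree p. coeff p i * 0)) at_top"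
    by (intro tendsto_sum tendsto_mult tendsto_const tendsto_power_div_exp_0)
  then show ?thesis
    by (simp add: poly_altdef sum_distrib_right sum_divide_distrib exp_minus field_simps)
qed

lemma flat_exp_has_field_derivative:
  "(flat_exp p has_field_derivative flat_exp ([:0, 0, 1:] * (p - pderiv p)) x) (at x)"
proof -
  consider "x > 0" | "x < 0" | "x = 0" by linarith
  then show ?thesis
  proof cases
    case 1
    have "((\<lambda>x. poly p (1 / x) * exp (- (1 / x))) has_field_derivative
            flat_exp ([:0, 0, 1:] * (p - pderiv p)) x) (at x)"
      using 1 by (auto intro!: derivative_eq_intros DERIV_chain2[OF poly_DERIV]
          simp: flat_exp_def field_simps power2_eq_square)
    then show ?thesis
      by (rule has_field_derivative_transform_within_open[where S = "{0<..}"])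
         (use 1 in \<open>auto simp: flat_exp_def\<close>)
  next
    case 2
    show ?thesis
      by (rule has_field_derivative_transform_within_open[where S = "{..<0}" and f = "\<lambda>_. 0"])
         (use 2 in \<open>auto simp: flat_exp_def\<close>)
  next
    case 3
    have "((\<lambda>y. flat_exp p y / y) \<longlongrightarrow> 0) (at_right 0)"
    proof -
      \<comment> \<open>Dividing by \<open>y\<close> multiplies the polynomial in
        \<open>1 / y\<close> by its variable, which is \<open>pCons 0 p\<close>; so the difference
        quotient at \<open>0\<close> is again of the same class.\<close>
      have "((\<lambda>y. poly (pCons 0 p) (inverse y) * exp (- inverse y)) \<longlongrightarrow> 0) (at_right 0)"
        by (rule filterlim_compose[OF poly_div_exp_tendsto_0 filterlim_inverse_at_top_right])
      then show ?thesis
        by (rule Lim_transform_eventually)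
           (auto simp: eventually_at_right_field flat_exp_def field_simps intro!: exI[of _ 1])
    qed
    moreover have "((\<lambda>y. flat_exp p y / y) \<longlongrightarrow> 0) (at_left 0)"
      by (rule Lim_transform_eventually[OF tendsto_const])
         (auto simp: eventually_at_left_field flat_exp_def intro!: exI[of _ "-1"])
    ultimately show ?thesis
      using 3 by (simp add: has_field_derivative_iff flat_exp_def filterlim_split_at)
  qed
qed

lemma smooth_on_flat_exp: "smooth_on (flat_exp p) UNIV"
proof -
  have "Ck_on k (flat_exp p) UNIV" for k
  proof (induction k arbitrary: p)
    case 0
    show ?case
      unfolding Ck_on.simps
      by (intro continuous_at_imp_continuous_on ballI DERIV_isCont[OF flat_exp_has_field_derivative])
  next
    case (Suc k)
    let ?q = "[:0, 0, 1:] * (p - pderiv p)"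
    have "Ck_on k (\<lambda>x. flat_exp ?q x * v) UNIV" for v
      by (intro Ck_on_bilinear[OF bounded_bilinear_mult] Ck_on_const Suc.IH)
    then show ?case
      using flat_exp_has_field_derivative[unfolded has_field_derivative_def]
      by (intro Ck_on_SucI) 
  qed
  then show ?thesis by (simp add: smooth_on_def)
qed

lemma smooth_bump_exists:
  fixes a :: "'a::euclidean_space"
  assumes "r > 0"
  obtains \<phi> :: "'a \<Rightarrow> real"
  where "smooth_on \<phi> UNIV" "\<And>x. \<phi> x \<ge> 0" "\<And>x. \<phi> x > 0 \<longleftrightarrow> x \<in> ball a r"
proof
  \<comment> \<open>The profile is \<open>exp (- 1 / u)\<close> for \<open>u > 0\<close>, taken at
    \<open>u = r\<^sup>2 - |x - a|\<^sup>2\<close>. The squared distance keeps the inner function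
    smooth at the centre, and \<open>u > 0\<close> describes the open ball.\<close>
  let ?\<phi> = "\<lambda>x. flat_exp 1 (r\<^sup>2 - (x - a) \<bullet> (x - a))"
  show "smooth_on ?\<phi> UNIV"
    by (intro smooth_on_compose[OF smooth_on_flat_exp] smooth_on_diff smooth_on_const
        smooth_on_inner smooth_on_ident)
  show "?\<phi> x \<ge> 0" for x by (simp add: flat_exp_def)
  have "?\<phi> x > 0 \<longleftrightarrow> (dist a x)\<^sup>2 < r\<^sup>2" for x
    by (simp add: flat_exp_def dist_norm norm_minus_commute dot_square_norm)
  moreover have "(dist a x)\<^sup>2 < r\<^sup>2 \<longleftrightarrow> dist a x < r" for x
    using assms by (metis abs_of_nonneg abs_of_pos abs_square_less_1 power2_less_imp_less
      power_strict_mono zero_le_dist less_imp_le pos2)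
  ultimately show "?\<phi> x > 0 \<longleftrightarrow> x \<in> ball a r" for x by simp
qed

subsection \<open>Time and space derivatives on a slab\<close>

abbreviation slab :: "real \<Rightarrow> real \<Rightarrow> ((real^3) \<times> real) set" where
  "slab t1 t2 \<equiv> UNIV \<times> {t1..t2}"

abbreviation smooth_slab :: "real \<Rightarrow> real \<Rightarrow> (real^3 \<Rightarrow> real \<Rightarrow> 'b::euclidean_space) \<Rightarrow> bool" where
  "smooth_slab t1 t2 f \<equiv> smooth_on (\<lambda>z. f (fst z) (snd z)) (slab t1 t2)"

text \<open>Chain rule along coordinate lines. A line in a space direction never leaves the slab, so
  the space derivative is two-sided even at the boundary times; a time line meets the slab in
  \<open>{t1..t2}\<close> only.\<close>

lemma slab_has_derivative_imp_directional:
  fixes f :: "real^3 \<Rightarrow> real \<Rightarrow> 'b::euclidean_space"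
  assumes f': "\<And>z. z \<in> slab t1 t2 \<Longrightarrow>
      ((\<lambda>z. f (fst z) (snd z)) has_derivative f' z) (at z within slab t1 t2)"
    and t: "t \<in> {t1..t2}"
  shows "((\<lambda>s. f x s) has_vector_derivative f' (x, t) (0, 1)) (at t within {t1..t2})"
    and "((\<lambda>r. f (x + r *\<^sub>R axis i 1) t) has_vector_derivative
            f' (x + r *\<^sub>R axis i 1, t) (axis i 1, 0)) (at r)"
proof -
  have "((\<lambda>s. f (fst (x, s)) (snd (x, s))) has_derivative (\<lambda>v. f' (x, t) (0, v))) (at t within {t1..t2})"
    by (rule has_derivative_in_compose2[OF f', where s = "{t1..t2}"])
       (use t in \<open>auto intro!: derivative_eq_intros\<close>)
  moreover have "linear (f' (x, t))" using f'[of "(x, t)"] t has_derivative_linear by auto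
  then have "f' (x, t) (0, v) = v *\<^sub>R f' (x, t) (0, 1)" for v
    using linear_scale[of "f' (x, t)" v "(0, 1)"] by simp
  then have "(\<lambda>v. f' (x, t) (0, v)) = (\<lambda>v. v *\<^sub>R f' (x, t) (0, 1))" by (rule ext)
  ultimately show "((\<lambda>s. f x s) has_vector_derivative f' (x, t) (0, 1)) (at t within {t1..t2})"
    by (simp add: has_vector_derivative_def)
  let ?y = "x + r *\<^sub>R axis i 1"
  have "((\<lambda>r. f (fst (x + r *\<^sub>R axis i 1, t)) (snd (x + r *\<^sub>R axis i 1, t))) has_derivative
          (\<lambda>v. f' (?y, t) (v *\<^sub>R axis i 1, 0))) (at r within UNIV)"
    by (rule has_derivative_in_compose2[OF f', where s = UNIV])
       (use t in \<open>auto intro!: derivative_eq_intros\<close>)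
  moreover have "linear (f' (?y, t))" using f'[of "(?y, t)"] t has_derivative_linear by auto
  then have "f' (?y, t) (v *\<^sub>R axis i 1, 0) = v *\<^sub>R f' (?y, t) (axis i 1, 0)" for v
    using linear_scale[of "f' (?y, t)" v "(axis i 1, 0)"] by simp
  then have "(\<lambda>v. f' (?y, t) (v *\<^sub>R axis i 1, 0)) = (\<lambda>v. v *\<^sub>R f' (?y, t) (axis i 1, 0))"
    by (rule ext)
  ultimately show "((\<lambda>r. f (x + r *\<^sub>R axis i 1) t) has_vector_derivative
            f' (?y, t) (axis i 1, 0)) (at r)"
    by (simp add: has_vector_derivative_def)
qed

lemma slab_derivative_directional_eq:
  fixes f :: "real^3 \<Rightarrow> real \<Rightarrow> 'b::euclidean_space"
  assumes f': "\<And>z. z \<in> slab t1 t2 \<Longrightarrow>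
      ((\<lambda>z. f (fst z) (snd z)) has_derivative f' z) (at z within slab t1 t2)"
    and t: "t \<in> {t1..t2}" and "t1 < t2"
  shows "time_deriv t1 t2 (f x) t = f' (x, t) (0, 1)"
    and "partial i (\<lambda>y. f y t) x = f' (x, t) (axis i 1, 0)"
proof -
  show "time_deriv t1 t2 (f x) t = f' (x, t) (0, 1)"
    unfolding time_deriv_def
    using slab_has_derivative_imp_directional(1)[OF f' t] t \<open>t1 < t2\<close>
    by (intro vector_derivative_within_closed_interval) auto
  show "partial i (\<lambda>y. f y t) x = f' (x, t) (axis i 1, 0)"
    using slab_has_derivative_imp_directional(2)[OF f' t, where r = 0 and x = x and i = i]
    by (auto simp: partial_def intro: vector_derivative_at)
qed

text \<open>Links two languages: integration by parts uses a total derivative on the slab, the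
  equations of motion use \<open>time_deriv\<close> and \<open>partial\<close>.\<close>

lemma smooth_slab_has_derivative:
  assumes "smooth_slab t1 t2 f" "t1 < t2"
  obtains f' where
    "\<And>z. z \<in> slab t1 t2 \<Longrightarrow> ((\<lambda>z. f (fst z) (snd z)) has_derivative f' z) (at z within slab t1 t2)"
    "\<And>v. continuous_on (slab t1 t2) (\<lambda>z. f' z v)"
    "\<And>x t. t \<in> {t1..t2} \<Longrightarrow> f' (x, t) (0, 1) = time_deriv t1 t2 (f x) t"
    "\<And>x t i. t \<in> {t1..t2} \<Longrightarrow> f' (x, t) (axis i 1, 0) = partial i (\<lambda>y. f y t) x"
proof -
  obtain f' where f':
    "\<And>z. z \<in> slab t1 t2 \<Longrightarrow> ((\<lambda>z. f (fst z) (snd z)) has_derivative f' z) (at z within slab t1 t2)"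
    "\<And>v. continuous_on (slab t1 t2) (\<lambda>z. f' z v)"
    using smooth_onD[OF assms(1)] by blast
  show thesis
    by (rule that[OF f']) (simp_all add: slab_derivative_directional_eq[OF f'(1) _ assms(2)])
qed

lemma has_time_deriv:
  assumes "smooth_slab t1 t2 f" "t1 < t2" "t \<in> {t1..t2}"
  shows "(f x has_vector_derivative time_deriv t1 t2 (f x) t) (at t within {t1..t2})"
proof (rule smooth_slab_has_derivative[OF assms(1,2)])
  fix f'
  assume "\<And>x t. t \<in> {t1..t2} \<Longrightarrow> f' (x, t) (0, 1) = time_deriv t1 t2 (f x) t"
    and "\<And>z. z \<in> slab t1 t2 \<Longrightarrow> ((\<lambda>z. f (fst z) (snd z)) has_derivative f' z) (at z within slab t1 t2)"
  then show ?thesis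
    using slab_has_derivative_imp_directional(1)[of t1 t2 f f' t x] assms(3) by simp
qed

lemma has_partial:
  assumes "smooth_slab t1 t2 f" "t1 < t2" "t \<in> {t1..t2}"
  shows "((\<lambda>r. f (x + r *\<^sub>R axis i 1) t) has_vector_derivative
            partial i (\<lambda>y. f y t) (x + r *\<^sub>R axis i 1)) (at r)"
proof (rule smooth_slab_has_derivative[OF assms(1,2)])
  fix f'
  assume "\<And>x t i. t \<in> {t1..t2} \<Longrightarrow> f' (x, t) (axis i 1, 0) = partial i (\<lambda>y. f y t) x"
    and "\<And>z. z \<in> slab t1 t2 \<Longrightarrow> ((\<lambda>z. f (fst z) (snd z)) has_derivative f' z) (at z within slab t1 t2)"
  then show ?thesis
    using slab_has_derivative_imp_directional(2)[of t1 t2 f f' t x i r] assms(3) by simp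
qed

lemma has_partial_0:
  assumes "smooth_slab t1 t2 f" "t1 < t2" "t \<in> {t1..t2}"
  shows "((\<lambda>r. f (x + r *\<^sub>R axis i 1) t) has_vector_derivative partial i (\<lambda>y. f y t) x) (at 0)"
  using has_partial[OF assms, where r = 0] by simp

lemma time_derivI:
  fixes f :: "real \<Rightarrow> 'b::euclidean_space"
  assumes "(f has_vector_derivative f') (at t within {t1..t2})" "t1 < t2" "t \<in> {t1..t2}"
  shows "time_deriv t1 t2 f t = f'"
  unfolding time_deriv_def
  by (rule vector_derivative_within_closed_interval) (use assms in auto)

lemma partialI:
  assumes "((\<lambda>r. f (x + r *\<^sub>R axis i 1)) has_vector_derivative f') (at 0)"
  shows "partial i f x = f'"
  unfolding partial_def using assms by (rule vector_derivative_at)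

text \<open>The derivative witness may change with the order \<open>k\<close>, but its values in the
  coordinate directions are always the same functions \<open>time_deriv\<close> and
  \<open>partial\<close>.\<close>

lemma smooth_slab_derivs:
  assumes "smooth_slab t1 t2 f" "t1 < t2"
  shows "smooth_slab t1 t2 (\<lambda>x t. time_deriv t1 t2 (f x) t)"
    and "smooth_slab t1 t2 (\<lambda>x t. partial i (\<lambda>y. f y t) x)"
proof -
  have "Ck_on k (\<lambda>z. time_deriv t1 t2 (f (fst z)) (snd z)) (slab t1 t2) \<and>
    Ck_on k (\<lambda>z. partial i (\<lambda>y. f y (snd z)) (fst z)) (slab t1 t2)" for k
  proof -
    have "Ck_on (Suc k) (\<lambda>z. f (fst z) (snd z)) (slab t1 t2)"
      using assms(1) by (simp only: smooth_on_def)
    then obtain f' where f':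
      "\<And>z. z \<in> slab t1 t2 \<Longrightarrow> ((\<lambda>z. f (fst z) (snd z)) has_derivative f' z) (at z within slab t1 t2)"
      "\<And>v. Ck_on k (\<lambda>z. f' z v) (slab t1 t2)"
      using Ck_on_SucE by blast
    show ?thesis
      by (intro conjI Ck_on_cong[OF f'(2)[of "(0, 1)"]] Ck_on_cong[OF f'(2)[of "(axis i 1, 0)"]])
         (auto simp: slab_derivative_directional_eq[OF f'(1) _ assms(2)])
  qed
  then show "smooth_slab t1 t2 (\<lambda>x t. time_deriv t1 t2 (f x) t)"
    "smooth_slab t1 t2 (\<lambda>x t. partial i (\<lambda>y. f y t) x)"
    by (simp_all add: smooth_on_def)
qed

text \<open>
  Mixed derivatives commute up to the boundary of the slab: differentiate
  \<open>f(x,s) = f(x,t1) + \<integral> \<partial>\<^sub>t f\<close> under the integral sign.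
\<close>

lemma time_deriv_partial_commute:
  assumes f: "smooth_slab t1 t2 f" and t12: "t1 < t2" and t: "t \<in> {t1..t2}"
  shows "time_deriv t1 t2 (\<lambda>s. partial i (\<lambda>y. f y s) x) t
           = partial i (\<lambda>y. time_deriv t1 t2 (f y) t) x"
proof -
  define g where "g = (\<lambda>y. time_deriv t1 t2 (f y))"
  define h where "h = (\<lambda>y s. partial i (\<lambda>y. g y s) y)"
  have g: "smooth_slab t1 t2 g" unfolding g_def by (rule smooth_slab_derivs(1)[OF f t12])
  have h: "smooth_slab t1 t2 h" unfolding h_def by (rule smooth_slab_derivs(2)[OF g t12])
  have hc: "continuous_on (slab t1 t2) (\<lambda>z. h (fst z) (snd z))"
    by (rule smooth_on_imp_continuous_on[OF h])
  have gi: "(g y has_integral f y s - f y t1) {t1..s}" if "s \<in> {t1..t2}" for y s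
  proof (rule fundamental_theorem_of_calculus)
    fix r assume "r \<in> {t1..s}"
    then show "(f y has_vector_derivative g y r) (at r within {t1..s})"
      unfolding g_def using that
      by (intro has_vector_derivative_within_subset[OF has_time_deriv[OF f t12]]) auto
  qed (use that in auto)
  have eq: "partial i (\<lambda>y. f y s) x = partial i (\<lambda>y. f y t1) x + integral {t1..s} (h x)"
    if s: "s \<in> {t1..t2}" for s
  proof (rule partialI)
    let ?y = "\<lambda>r. x + r *\<^sub>R axis i 1"
    have "((\<lambda>r. integral (cbox t1 s) (g (?y r))) has_vector_derivative
            integral (cbox t1 s) (h (?y 0))) (at 0 within UNIV)"
    proof (rule leibniz_rule_vector_derivative[where fx = "\<lambda>r. h (?y r)"])
      fix r r' assume "r' \<in> cbox t1 s"
      then have "r' \<in> {t1..t2}" using s by auto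
      then show "((\<lambda>r. g (?y r) r') has_vector_derivative h (?y r) r') (at r within UNIV)"
        unfolding h_def using has_partial[OF g t12] by simp
    next
      show "g (?y r) integrable_on cbox t1 s" for r
        using gi[OF s] by (auto simp: has_integral_integrable)
    next
      have "continuous_on (UNIV \<times> cbox t1 s) (\<lambda>w. h (fst (?y (fst w), snd w)) (snd (?y (fst w), snd w)))"
        by (rule continuous_on_compose2[OF hc]) (use s in \<open>auto intro!: continuous_intros\<close>)
      then show "continuous_on (UNIV \<times> cbox t1 s) (\<lambda>(r, r'). h (?y r) r')"
        by (simp add: case_prod_unfold)
    qed auto
    then have "((\<lambda>r. f (?y r) t1 + integral (cbox t1 s) (g (?y r))) has_vector_derivative
        partial i (\<lambda>y. f y t1) x + integral {t1..s} (h x)) (at 0)"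
      using t12 by (intro has_vector_derivative_add has_partial_0[OF f]) auto
    moreover have "f y t1 + integral (cbox t1 s) (g y) = f y s" for y
      using integral_unique[OF gi[OF s]] by simp
    ultimately show "((\<lambda>r. f (?y r) s) has_vector_derivative
        partial i (\<lambda>y. f y t1) x + integral {t1..s} (h x)) (at 0)" by simp
  qed
  have "continuous_on {t1..t2} (\<lambda>s. h (fst (x, s)) (snd (x, s)))"
    by (rule continuous_on_compose2[OF hc]) (auto intro!: continuous_intros)
  then have "((\<lambda>s. integral {t1..s} (h x)) has_vector_derivative h x t) (at t within {t1..t2})"
    by (intro integral_has_vector_derivative t) simp
  \<comment> \<open>The term at \<open>t1\<close> is constant in \<open>s\<close>, so the
    fundamental theorem alone gives the time derivative, one-sided at the endpoints.\<close>
  then have "((\<lambda>s. partial i (\<lambda>y. f y t1) x + integral {t1..s} (h x)) has_vector_derivative 0 + h x t)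
      (at t within {t1..t2})"
    by (intro has_vector_derivative_add has_vector_derivative_const)
  then have "((\<lambda>s. partial i (\<lambda>y. f y s) x) has_vector_derivative 0 + h x t) (at t within {t1..t2})"
    by (rule has_vector_derivative_transform[OF t, rotated]) (rule eq)
  then show ?thesis
    using time_derivI[OF _ t12 t] by (force simp: h_def g_def)
qed

subsection \<open>Integration of compactly supported functions\<close>

lemma has_derivative_eq_0_off_support:
  assumes "(g has_derivative g') (at x)" "closed K" "x \<notin> K" "\<And>y. y \<notin> K \<Longrightarrow> g y = 0"
  shows "g' v = 0"
proof -
  have "(g has_derivative (\<lambda>_. 0)) (at x)"
    by (rule has_derivative_transform_within_open[where s = "- K", OF has_derivative_const[of 0]])
       (use assms in auto)
  then show ?thesis using assms(1) has_derivative_unique by metis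
qed

lemma integrable_lborel_compact_support:
  fixes h :: "'a::euclidean_space \<Rightarrow> 'b::{banach, second_countable_topology}"
  assumes "compact K" "continuous_on K h" "\<And>x. x \<notin> K \<Longrightarrow> h x = 0"
  shows "integrable lborel h"
proof -
  have "(\<lambda>x. indicator K x *\<^sub>R h x) = h"
    using assms(3) by (auto simp: indicator_def fun_eq_iff)
  then show ?thesis
    using borel_integrable_compact[OF assms(1,2)] by simp
qed

lemma lborel_integral_shift:
  fixes f :: "'a::euclidean_space \<Rightarrow> 'b::{banach, second_countable_topology}"
  assumes "f \<in> borel_measurable borel"
  shows "(LINT x|lborel. f (c + x)) = integral\<^sup>L lborel f"
  by (subst lborel_distr_plus[symmetric, of c], subst integral_distr) (use assms in auto)

text \<open>
  By translation invariance all difference quotients have integral \<open>0\<close>; they converge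
  dominatedly to the directional derivative.
\<close>

lemma integral_directional_derivative_eq_0:
  fixes g :: "'a::euclidean_space \<Rightarrow> real"
  assumes deriv: "\<And>x. (g has_derivative g' x) (at x)"
    and cont: "continuous_on UNIV (\<lambda>x. g' x v)"
    and K: "compact K" "\<And>x. x \<notin> K \<Longrightarrow> g x = 0"
  shows "(LINT x|lborel. g' x v) = 0"
proof -
  have g'0: "g' x v = 0" if "x \<notin> K" for x
    using has_derivative_eq_0_off_support[OF deriv compact_imp_closed[OF K(1)] that K(2)] .
  have gc: "continuous_on UNIV g"
    using deriv by (meson continuous_at_imp_continuous_on has_derivative_continuous)
  then have gm: "g \<in> borel_measurable borel" by (rule borel_measurable_continuous_onI)
  have "compact ((\<lambda>x. g' x v) ` K)"
    by (rule compact_continuous_image[OF continuous_on_subset[OF cont] K(1)]) simp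
  then obtain M where M: "0 < M" "\<And>x. x \<in> K \<Longrightarrow> \<bar>g' x v\<bar> \<le> M"
    using compact_imp_bounded bounded_pos by (metis image_eqI real_norm_def)
  then have M': "\<bar>g' x v\<bar> \<le> M" for x
    using g'0 by (cases "x \<in> K") auto
  \<comment> \<open>\<open>K\<close> swept backwards along \<open>v\<close>. If \<open>x\<close> is
    not in \<open>K'\<close>, then neither \<open>x\<close> nor \<open>x + r *\<^sub>R v\<close>
    with \<open>r \<le> 1\<close> lies in \<open>K\<close>, so this one compact set carries all the
    difference quotients.\<close>
  define K' where "K' = (\<lambda>(y, r). y - r *\<^sub>R v) ` (K \<times> {0..1::real})"
  have "compact K'"
    unfolding K'_def case_prod_unfold
    by (intro compact_continuous_image compact_Times K(1) compact_Icc continuous_intros)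
  have line: "((\<lambda>r. g (x + r *\<^sub>R v)) has_real_derivative g' (x + r *\<^sub>R v) v) (at r)" for x r
  proof -
    have "((\<lambda>r. g (x + r *\<^sub>R v)) has_derivative (\<lambda>s. g' (x + r *\<^sub>R v) (s *\<^sub>R v))) (at r)"
      by (rule has_derivative_compose[OF _ deriv]) (auto intro!: derivative_eq_intros)
    moreover have "linear (g' (x + r *\<^sub>R v))" using deriv has_derivative_linear by blast
    ultimately show ?thesis
      by (simp add: has_field_derivative_def linear_scale mult.commute[of _ "g' _ v"])
  qed
  define s where "s = (\<lambda>n x. real (Suc n) * (g (inverse (real (Suc n)) *\<^sub>R v + x) - g x))"
  have "(\<lambda>n. integral\<^sup>L lborel (s n)) \<longlonglongrightarrow> (LINT x|lborel. g' x v)"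
  proof (rule integral_dominated_convergence[where w = "\<lambda>x. indicator K' x *\<^sub>R M"])
    show "(\<lambda>x. g' x v) \<in> borel_measurable lborel"
      using borel_measurable_continuous_onI[OF cont] by simp
    show "s n \<in> borel_measurable lborel" for n
      unfolding s_def using gm by measurable
    show "integrable lborel (\<lambda>x. indicator K' x *\<^sub>R M)"
      by (rule borel_integrable_compact[OF \<open>compact K'\<close> continuous_on_const])
    show "AE x in lborel. (\<lambda>n. s n x) \<longlonglongrightarrow> g' x v"
    proof (rule AE_I2)
      fix x
      have "((\<lambda>r. (g (x + r *\<^sub>R v) - g x) / r) \<longlongrightarrow> g' x v) (at 0)"
        using line[of x 0] by (simp add: DERIV_def)
      moreover have "filterlim (\<lambda>n. inverse (real (Suc n))) (at 0) sequentially"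
        by (simp add: filterlim_at LIMSEQ_inverse_real_of_nat del: of_nat_Suc)
      ultimately have "(\<lambda>n. (g (x + inverse (real (Suc n)) *\<^sub>R v) - g x) / inverse (real (Suc n)))
          \<longlonglongrightarrow> g' x v"
        by (rule filterlim_compose)
      then show "(\<lambda>n. s n x) \<longlonglongrightarrow> g' x v"
        by (simp add: s_def add.commute mult.commute divide_inverse del: of_nat_Suc)
    qed
    show "AE x in lborel. norm (s n x) \<le> indicator K' x *\<^sub>R M" for n
    proof (rule AE_I2)
      fix x
      define r where "r = inverse (real (Suc n))"
      have r: "0 < r" "r \<le> 1" by (auto simp: r_def inverse_le_1_iff)
      have s: "s n x = (g (x + r *\<^sub>R v) - g x) / r"
        by (simp add: s_def r_def add.commute divide_inverse)
      \<comment> \<open>The mean value theorem bounds every quotient by the bound \<open>M\<close>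
        on the derivative, uniformly in the step size.\<close>
      obtain z where "g (x + r *\<^sub>R v) - g (x + 0 *\<^sub>R v) = (r - 0) * g' (x + z *\<^sub>R v) v"
        using MVT2[OF r(1) line] by metis
      then have "\<bar>s n x\<bar> \<le> M" using M' r by (simp add: s)
      moreover have "s n x = 0" if "x \<notin> K'"
      proof -
        have "x + q *\<^sub>R v \<notin> K" if "q \<in> {0..1}" for q
        proof
          assume "x + q *\<^sub>R v \<in> K"
          then have "(x + q *\<^sub>R v) - q *\<^sub>R v \<in> K'" unfolding K'_def using that by force
          then show False using \<open>x \<notin> K'\<close> by simp
        qed
        from this[of r] this[of 0] show ?thesis using K(2) r by (simp add: s)
      qed
      ultimately show "norm (s n x) \<le> indicator K' x *\<^sub>R M"
        by (auto simp: indicator_def)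
    qed
  qed
  moreover have "integral\<^sup>L lborel (s n) = 0" for n
  proof -
    let ?c = "inverse (real (Suc n)) *\<^sub>R v"
    have i: "integrable lborel g"
      by (rule integrable_lborel_compact_support[OF K(1) continuous_on_subset[OF gc] K(2)]) auto
    have "integrable (distr lborel borel ((+) ?c)) g" using i by (simp add: lborel_distr_plus)
    then have "integrable lborel (\<lambda>x. g (?c + x))"
      by (subst (asm) integrable_distr_eq) (use gm in auto)
    then show ?thesis
      unfolding s_def using i by (simp add: lborel_integral_shift[OF gm])
  qed
  ultimately show ?thesis by (simp add: LIMSEQ_const_iff)
qed

text \<open>The integral forces \<open>h = 0\<close> almost everywhere, while the points of
  \<open>U\<close> with \<open>h \<noteq> 0\<close> form an open set; a nonempty open set is not
  negligible.\<close>

lemma nonneg_integral_eq_0_imp_eq_0_on_open: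
  fixes h :: "'a::euclidean_space \<Rightarrow> real"
  assumes "integrable lborel h" "integral\<^sup>L lborel h = 0" "\<And>x. h x \<ge> 0"
    and U: "open U" "continuous_on U h" "x \<in> U"
  shows "h x = 0"
proof (rule ccontr)
  assume "h x \<noteq> 0"
  have "AE x in lborel. h x = 0"
    using integral_nonneg_eq_0_iff_AE[OF assms(1)] assms(2,3) by auto
  then obtain N where N: "{x. h x \<noteq> 0} \<subseteq> N" "N \<in> null_sets lborel"
    unfolding eventually_ae_filter by auto
  have "open (U \<inter> h -` (- {0}))"
    using U by (metis open_Compl closed_singleton continuous_on_open_vimage Int_commute)
  moreover have "negligible (U \<inter> h -` (- {0}))"
  proof (rule negligible_subset)
    show "negligible N" using N(2) by (simp add: negligible_iff_null_sets null_sets_completionI)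
    show "U \<inter> h -` (- {0}) \<subseteq> N" using N(1) by auto
  qed
  ultimately show False
    using open_not_negligible \<open>x \<in> U\<close> \<open>h x \<noteq> 0\<close> by blast
qed

text \<open>Fubini for an integrand controlled only on the slab: it is applied to the product with
  \<open>indicator K\<close>, which is integrable on the whole space and agrees with
  \<open>h\<close> at all times in \<open>{t1..t2}\<close>.\<close>

lemma slab_iterated_integral:
  fixes h :: "(real^3) \<times> real \<Rightarrow> real"
  assumes K: "compact K" "K \<subseteq> slab t1 t2" and h: "continuous_on (slab t1 t2) h"
    and h0: "\<And>z. z \<in> slab t1 t2 \<Longrightarrow> z \<notin> K \<Longrightarrow> h z = 0"
  shows "(LINT t:{t1..t2}|lborel. LINT x|lborel. h (x, t)) = (LINT z|lborel. indicator K z * h z)"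
proof -
  let ?F = "\<lambda>z. indicator K z * h z"
  have "integrable lborel (\<lambda>z. indicator K z *\<^sub>R h z)"
    by (rule borel_integrable_compact[OF K(1) continuous_on_subset[OF h K(2)]])
  then have F: "integrable (lborel \<Otimes>\<^sub>M lborel) (\<lambda>(x, t). ?F (x, t))"
    by (simp add: lborel_prod case_prod_unfold)
  have "indicator {t1..t2} t *\<^sub>R (LINT x|lborel. h (x, t)) = (LINT x|lborel. ?F (x, t))" for t
  proof (cases "t \<in> {t1..t2}")
    case True
    then have "h (x, t) = ?F (x, t)" for x
      using h0[of "(x, t)"] by (auto simp: indicator_def)
    then have "(\<lambda>x. h (x, t)) = (\<lambda>x. ?F (x, t))" by (rule ext)
    then show ?thesis using True by simp
  next
    case False
    then have "(x, t) \<notin> K" for x using K(2) by auto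
    then show ?thesis using False by simp
  qed
  then show ?thesis
    unfolding set_lebesgue_integral_def
    using lborel_pair.integral_snd[OF F] by (simp add: lborel_prod case_prod_unfold)
qed

text \<open>Since \<open>\<eta>\<close> vanishes off a compact subset of the open slab, the product
  \<open>m z \<bullet> \<eta> z\<close> extended by zero is differentiable on the whole space, and
  its derivative along \<open>v\<close> integrates to \<open>0\<close>.\<close>

lemma slab_integration_by_parts:
  fixes m \<eta> :: "(real^3) \<times> real \<Rightarrow> 'b::euclidean_space"
  assumes m': "\<And>z. z \<in> slab t1 t2 \<Longrightarrow> (m has_derivative m' z) (at z within slab t1 t2)"
      "continuous_on (slab t1 t2) (\<lambda>z. m' z v)"
    and \<eta>': "\<And>z. (\<eta> has_derivative \<eta>' z) (at z)" "continuous_on UNIV (\<lambda>z. \<eta>' z v)"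
    and K: "compact K" "K \<subseteq> UNIV \<times> {t1<..<t2}" "\<And>z. z \<notin> K \<Longrightarrow> \<eta> z = 0"
  shows "(LINT z|lborel. indicator K z * (m' z v \<bullet> \<eta> z + m z \<bullet> \<eta>' z v)) = 0"
proof -
  let ?O = "UNIV \<times> {t1<..<t2} :: ((real^3) \<times> real) set"
  define g where "g = (\<lambda>z. indicator K z * (m z \<bullet> \<eta> z))"
  define g' where "g' = (\<lambda>z w. indicator K z * (m z \<bullet> \<eta>' z w + m' z w \<bullet> \<eta> z))"
  have O: "open ?O" by (intro open_Times) auto
  have sub: "?O \<subseteq> slab t1 t2" by auto
  have K': "open (- K)" using K(1) compact_imp_closed by blast
  have \<eta>'0: "\<eta>' z w = 0" if "z \<notin> K" for z w
    using has_derivative_eq_0_off_support[OF \<eta>'(1) compact_imp_closed[OF K(1)] that K(3)] .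
  \<comment> \<open>Off \<open>K\<close> both \<open>\<eta>\<close> and its derivative vanish, so
    the indicator changes no value. Without it the product rule applies; with it the vanishing off
    \<open>K\<close> is immediate.\<close>
  have g_eq: "g z = m z \<bullet> \<eta> z" "g' z w = m z \<bullet> \<eta>' z w + m' z w \<bullet> \<eta> z" for z w
    using K(3)[of z] \<eta>'0[of z w] by (cases "z \<in> K"; simp add: g_def g'_def)+
  have gd: "(g has_derivative g' z) (at z)" for z
  proof (cases "z \<in> K")
    case True
    then have z: "z \<in> ?O" using K(2) by auto
    have "(m has_derivative m' z) (at z within ?O)"
      using m'(1) sub z by (blast intro: has_derivative_subset)
    then have "(m has_derivative m' z) (at z)" using at_within_open[OF z O] by simp
    then have "((\<lambda>z. m z \<bullet> \<eta> z) has_derivative (\<lambda>w. m z \<bullet> \<eta>' z w + m' z w \<bullet> \<eta> z)) (at z)"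
      by (rule bounded_bilinear.FDERIV[OF bounded_bilinear_inner _ \<eta>'(1)])
    then show ?thesis by (simp add: g_eq[abs_def])
  next
    case False
    then have "g' z = (\<lambda>_. 0)" by (simp add: g'_def fun_eq_iff)
    moreover have "(g has_derivative (\<lambda>_. 0)) (at z)"
      by (rule has_derivative_transform_within_open[where s = "- K", OF has_derivative_const[of 0]])
         (use K' False in \<open>auto simp: g_def\<close>)
    ultimately show ?thesis by simp
  qed
  have cm: "continuous_on (slab t1 t2) m" using m'(1) by (rule has_derivative_continuous_on)
  have c\<eta>: "continuous_on UNIV \<eta>"
    using \<eta>'(1) by (meson continuous_at_imp_continuous_on has_derivative_continuous)
  have "continuous_on ?O (\<lambda>z. g' z v)"
    unfolding g_eq
    by (intro continuous_intros continuous_on_subset[OF cm sub] continuous_on_subset[OF m'(2) sub]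
        continuous_on_subset[OF c\<eta>] continuous_on_subset[OF \<eta>'(2)]) auto
  moreover have "continuous_on (- K) (\<lambda>z. g' z v)"
    by (subst continuous_on_cong[OF refl, where g = "\<lambda>_. 0"]) (auto simp: g'_def)
  \<comment> \<open>Continuity is glued from two open sets that cover the space: the open slab and
    the complement of \<open>K\<close>.\<close>
  ultimately have "continuous_on (?O \<union> - K) (\<lambda>z. g' z v)"
    by (intro continuous_on_open_Un O K')
  moreover have "?O \<union> - K = UNIV" using K(2) by auto
  ultimately have "(LINT z|lborel. g' z v) = 0"
    by (intro integral_directional_derivative_eq_0[OF gd _ K(1)]) (auto simp: g_def)
  then show ?thesis by (simp add: g'_def add.commute)
qed

subsection \<open>Matrix algebra\<close>

lemma linear_transpose: "linear (transpose :: mat3 \<Rightarrow> mat3)"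
  by (auto intro!: linearI simp: transpose_def vec_eq_iff)

lemma bounded_linear_transpose: "bounded_linear (transpose :: mat3 \<Rightarrow> mat3)"
  using linear_transpose linear_conv_bounded_linear by blast

lemma bounded_bilinear_matrix_mult: "bounded_bilinear ((**) :: mat3 \<Rightarrow> mat3 \<Rightarrow> mat3)"
  unfolding bilinear_conv_bounded_bilinear[symmetric] bilinear_def
  by (auto intro!: linearI simp: matrix_matrix_mult_def vec_eq_iff sum.distrib algebra_simps sum_distrib_left)

interpretation matmul: bounded_bilinear "(**) :: mat3 \<Rightarrow> mat3 \<Rightarrow> mat3"
  by (rule bounded_bilinear_matrix_mult)

lemmas matrix_algebra = matmul.add_left matmul.add_right matmul.diff_left matmul.diff_right
  matmul.minus_left matmul.minus_right matrix_mul_assoc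

lemmas transpose_algebra = linear_add[OF linear_transpose] linear_diff[OF linear_transpose]
  linear_neg[OF linear_transpose] linear_scale[OF linear_transpose] linear_sum[OF linear_transpose]
  matrix_transpose_mul

lemma bounded_bilinear_commutator: "bounded_bilinear commutator"
  unfolding bilinear_conv_bounded_bilinear[symmetric] bilinear_def commutator_def
  by (auto intro!: linearI simp: matrix_algebra matmul.scaleR_left matmul.scaleR_right algebra_simps)

interpretation comm: bounded_bilinear commutator
  by (rule bounded_bilinear_commutator)

lemma pairing_eq_inner: "pairing A B = A \<bullet> B"
proof -
  have "pairing A B = (\<Sum>i\<in>UNIV. \<Sum>k\<in>UNIV. A $ k $ i * B $ k $ i)"
    by (simp add: pairing_def trace_def matrix_matrix_mult_def transpose_def)
  also have "\<dots> = A \<bullet> B"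
    by (subst sum.swap) (simp add: inner_vec_def)
  finally show ?thesis .
qed

lemma inner_matrix_mult:
  fixes A B C :: mat3
  shows "A \<bullet> (B ** C) = (transpose B ** A) \<bullet> C" and "A \<bullet> (B ** C) = (A ** transpose C) \<bullet> B"
proof -
  show "A \<bullet> (B ** C) = (transpose B ** A) \<bullet> C"
    by (simp add: pairing_eq_inner[symmetric] pairing_def matrix_transpose_mul matrix_mul_assoc)
  show "A \<bullet> (B ** C) = (A ** transpose C) \<bullet> B"
    using trace_mul_sym[of "transpose A ** B" C]
    by (simp add: pairing_eq_inner[symmetric] pairing_def matrix_transpose_mul matrix_mul_assoc)
qed

lemma inner_transpose: "transpose A \<bullet> B = A \<bullet> transpose B" for A B :: mat3
  by (simp add: inner_vec_def transpose_def) (rule sum.swap)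

text \<open>The adjoint of \<open>X \<mapsto> commutator X B\<close> is
  \<open>X \<mapsto> commutator X (transpose B)\<close>, hence a plus sign for symmetric and a minus
  sign for antisymmetric \<open>B\<close>. This difference is why \<open>Q\<close> stands first and
  \<open>\<gamma>\<close> second in the commutators of the final equation.\<close>

lemma inner_commutator_sym3:
  assumes "Q \<in> sym3"
  shows "A \<bullet> commutator X Q = commutator A Q \<bullet> X"
  using assms inner_matrix_mult(2)[of A X Q] inner_matrix_mult(1)[of A Q X]
  by (simp add: commutator_def sym3_def inner_diff)

lemma inner_commutator_so3:
  assumes "\<gamma> \<in> so3"
  shows "A \<bullet> commutator X \<gamma> = - (commutator A \<gamma> \<bullet> X)"
  using assms inner_matrix_mult(2)[of A X \<gamma>] inner_matrix_mult(1)[of A \<gamma> X]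
  by (simp add: commutator_def so3_def inner_diff matrix_algebra)

lemma commutator_swap: "commutator A B = - commutator B A"
  by (simp add: commutator_def)

lemma commutator_sym3_sym3: "A \<in> sym3 \<Longrightarrow> B \<in> sym3 \<Longrightarrow> commutator A B \<in> so3"
  by (simp add: sym3_def so3_def commutator_def transpose_algebra)

lemma commutator_so3_sym3: "A \<in> so3 \<Longrightarrow> B \<in> sym3 \<Longrightarrow> commutator A B \<in> sym3"
  by (simp add: sym3_def so3_def commutator_def transpose_algebra matrix_algebra)

lemma commutator_so3_so3: "A \<in> so3 \<Longrightarrow> B \<in> so3 \<Longrightarrow> commutator A B \<in> so3"
  by (simp add: so3_def commutator_def transpose_algebra matrix_algebra)

lemma subspace_so3: "subspace so3"
  by (auto simp: subspace_def so3_def transpose_algebra linear_0[OF linear_transpose])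

text \<open>
  The Jacobi identity turns \<open>[[\<eta>,\<nu>],Q] + [\<nu>,[\<eta>,Q]]\<close> into \<open>[\<eta>,[\<nu>,Q]]\<close>, which is orthogonal to
  the symmetric matrix \<open>[\<nu>,Q]\<close>.
\<close>

lemma kinetic_variation:
  assumes "\<nu> \<in> so3" "Q \<in> sym3"
  shows "commutator \<nu> Q \<bullet> (commutator (\<eta>' + commutator \<eta> \<nu>) Q + commutator \<nu> (commutator \<eta> Q))
           = commutator (commutator \<nu> Q) Q \<bullet> \<eta>'"
proof -
  let ?A = "commutator \<nu> Q"
  have A: "?A \<in> sym3" using assms by (rule commutator_so3_sym3)
  have "commutator (\<eta>' + commutator \<eta> \<nu>) Q + commutator \<nu> (commutator \<eta> Q)
      = commutator \<eta>' Q + commutator \<eta> ?A"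
    by (simp add: commutator_def matrix_algebra)
  moreover have "?A \<bullet> commutator \<eta> ?A = 0"
    using inner_commutator_sym3[OF A, of ?A \<eta>] by (simp add: commutator_def)
  ultimately show ?thesis
    using inner_commutator_sym3[OF assms(2), of ?A \<eta>'] by (simp add: inner_add_right)
qed

subsection \<open>Gradients with respect to the pairing\<close>

text \<open>Written as a finite basis sum so that smooth dependence of \<open>l\<close> on a
  parameter passes to the representative term by term.\<close>

definition riesz :: "(mat3 \<Rightarrow> real) \<Rightarrow> mat3" where
  "riesz l = (\<Sum>b\<in>Basis. l b *\<^sub>R b)"

lemma riesz_inner: "linear l \<Longrightarrow> riesz l \<bullet> X = l X"
proof -
  assume l: "linear l"
  have "l X = l (\<Sum>b\<in>Basis. (X \<bullet> b) *\<^sub>R b)" by (simp add: euclidean_representation)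
  also have "\<dots> = (\<Sum>b\<in>Basis. (X \<bullet> b) * l b)"
    by (simp add: linear_sum[OF l] linear_scale[OF l])
  also have "\<dots> = riesz l \<bullet> X"
    by (simp add: riesz_def inner_sum_left inner_commute[of X] mult.commute)
  finally show ?thesis by simp
qed

definition sym_part :: "mat3 \<Rightarrow> mat3" where
  "sym_part A = (1 / 2) *\<^sub>R (A + transpose A)"

definition antisym_part :: "mat3 \<Rightarrow> mat3" where
  "antisym_part A = (1 / 2) *\<^sub>R (A - transpose A)"

lemma sym_part_in_sym3: "sym_part A \<in> sym3"
  by (simp add: sym_part_def sym3_def transpose_algebra add.commute)

lemma antisym_part_in_so3: "antisym_part A \<in> so3"
  by (simp add: antisym_part_def so3_def transpose_algebra algebra_simps)

text \<open>Symmetric and antisymmetric matrices are orthogonal, so the discarded part of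
  \<open>A\<close> does not contribute.\<close>

lemma sym_part_inner: "X \<in> sym3 \<Longrightarrow> sym_part A \<bullet> X = A \<bullet> X"
  by (simp add: sym_part_def sym3_def inner_add_left inner_transpose)

lemma antisym_part_inner: "X \<in> so3 \<Longrightarrow> antisym_part A \<bullet> X = A \<bullet> X"
  by (simp add: antisym_part_def so3_def inner_diff_left inner_transpose)

text \<open>A derivative acts on all matrices, but \<open>is_gradient\<close> tests symmetric
  directions and asks for a symmetric representative; the projection \<open>sym_part\<close> meets
  both demands.\<close>

definition gradient_Q :: "(mat3 \<times> mat3_triple \<Rightarrow> real) \<Rightarrow> mat3" where
  "gradient_Q D = sym_part (riesz (\<lambda>b. D (b, 0)))"

definition gradient_\<gamma> :: "(mat3 \<times> mat3_triple \<Rightarrow> real) \<Rightarrow> mat3_triple" where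
  "gradient_\<gamma> D = (\<chi> i. antisym_part (riesz (\<lambda>b. D (0, axis i b))))"

lemma linear_decomposition_gradient:
  assumes D: "linear D" and "dQ \<in> sym3" "\<And>i. d\<gamma> $ i \<in> so3"
  shows "D (dQ, d\<gamma>) = gradient_Q D \<bullet> dQ + (\<Sum>i\<in>UNIV. gradient_\<gamma> D $ i \<bullet> d\<gamma> $ i)"
proof -
  have "d\<gamma> = (\<Sum>i\<in>UNIV. axis i (d\<gamma> $ i))"
    by (simp add: vec_eq_iff axis_def sum.delta')
  then have "(dQ, d\<gamma>) = (dQ, 0) + (\<Sum>i\<in>UNIV. (0, axis i (d\<gamma> $ i)))"
    by (simp add: sum_prod[symmetric] prod_eq_iff fst_sum snd_sum)
  then have "D (dQ, d\<gamma>) = D (dQ, 0) + (\<Sum>i\<in>UNIV. D (0, axis i (d\<gamma> $ i)))"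
    by (simp add: linear_add[OF D] linear_sum[OF D])
  moreover have "linear (\<lambda>b. D (b, 0))"
    by (rule linear_compose[OF _ D, unfolded o_def]) (auto intro!: linearI)
  moreover have "linear (\<lambda>b. D (0, axis i b))" for i
    by (rule linear_compose[OF _ D, unfolded o_def]) (auto intro!: linearI simp: vec_eq_iff axis_def)
  ultimately show ?thesis
    using assms(2,3)
    by (simp add: gradient_Q_def gradient_\<gamma>_def sym_part_inner antisym_part_inner riesz_inner)
qed

text \<open>The difference of two candidates has the right symmetry types, so it may serve as the
  test direction; this makes its squared norm zero.\<close>

lemma is_gradient_unique:
  assumes "is_gradient \<Psi> Q \<gamma> (S, G)" "is_gradient \<Psi> Q \<gamma> (S', G')"
  shows "(S, G) = (S', G')"
proof -
  have eq: "S \<bullet> dQ + (\<Sum>i\<in>UNIV. G $ i \<bullet> d\<gamma> $ i) = S' \<bullet> dQ + (\<Sum>i\<in>UNIV. G' $ i \<bullet> d\<gamma> $ i)"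
    if "dQ \<in> sym3" "\<And>i. d\<gamma> $ i \<in> so3" for dQ d\<gamma>
    using assms that by (simp add: is_gradient_def pairing_eq_inner)
  have mem: "S - S' \<in> sym3" "\<And>i. (G - G') $ i \<in> so3"
    using assms by (auto simp: is_gradient_def sym3_def so3_def transpose_algebra)
  have "(S - S') \<bullet> (S - S') + (\<Sum>i\<in>UNIV. (G - G') $ i \<bullet> (G - G') $ i) = 0"
    using eq[of "S - S'" "G - G'", OF mem]
    by (simp add: inner_diff_left sum_subtractf)
  moreover have "(\<Sum>i\<in>UNIV. (G - G') $ i \<bullet> (G - G') $ i) \<ge> 0" by (simp add: sum_nonneg)
  ultimately have "(S - S') \<bullet> (S - S') = 0" "(\<Sum>i\<in>UNIV. (G - G') $ i \<bullet> (G - G') $ i) = 0"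
    using inner_ge_zero[of "S - S'"] by linarith+
  then show ?thesis by (simp add: sum_nonneg_eq_0_iff vec_eq_iff)
qed

text \<open>Existence and uniqueness together evaluate the definite description behind
  \<open>grad_Q\<close> and \<open>grad_\<gamma>\<close>.\<close>

lemma gradient_eq:
  assumes "(\<lambda>(q, g). \<Psi> q g) differentiable (at (Q, \<gamma>))"
  defines "D \<equiv> frechet_derivative (\<lambda>(q, g). \<Psi> q g) (at (Q, \<gamma>))"
  shows "grad_Q \<Psi> Q \<gamma> = gradient_Q D" and "grad_\<gamma> \<Psi> Q \<gamma> i = gradient_\<gamma> D $ i"
proof -
  have D: "linear D" unfolding D_def by (rule linear_frechet_derivative[OF assms(1)])
  have "is_gradient \<Psi> Q \<gamma> (gradient_Q D, gradient_\<gamma> D)"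
    using linear_decomposition_gradient[OF D]
    by (simp add: is_gradient_def D_def[symmetric] pairing_eq_inner gradient_Q_def gradient_\<gamma>_def
        sym_part_in_sym3 antisym_part_in_so3)
  then have "(THE SG. is_gradient \<Psi> Q \<gamma> SG) = (gradient_Q D, gradient_\<gamma> D)"
    by (rule the_equality) (metis is_gradient_unique surj_pair \<open>is_gradient \<Psi> Q \<gamma> _\<close>)
  then show "grad_Q \<Psi> Q \<gamma> = gradient_Q D" "grad_\<gamma> \<Psi> Q \<gamma> i = gradient_\<gamma> D $ i"
    by (simp_all add: grad_Q_def grad_\<gamma>_def)
qed

lemma smooth_on_imp_differentiable: "smooth_on f UNIV \<Longrightarrow> f differentiable (at x)"
  by (metis UNIV_I differentiableI smooth_onD)

lemma smooth_on_gradient: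
  fixes Q :: "'a::euclidean_space \<Rightarrow> mat3"
  assumes \<Psi>: "smooth_on (\<lambda>(q, g). \<Psi> q g) UNIV" and Q: "smooth_on Q S" "smooth_on \<gamma> S"
  shows "smooth_on (\<lambda>z. grad_Q \<Psi> (Q z) (\<gamma> z)) S" and "smooth_on (\<lambda>z. grad_\<gamma> \<Psi> (Q z) (\<gamma> z) i) S"
proof -
  have diff: "(\<lambda>(q, g). \<Psi> q g) differentiable (at p)" for p
    by (rule smooth_on_imp_differentiable[OF \<Psi>])
  have D: "smooth_on (\<lambda>z. frechet_derivative (\<lambda>(q, g). \<Psi> q g) (at (Q z, \<gamma> z)) v) S" for v
    by (rule smooth_on_compose[OF smooth_on_frechet_derivative[OF \<Psi>] smooth_on_Pair[OF Q]])
  have r: "smooth_on (\<lambda>z. riesz (\<lambda>b. frechet_derivative (\<lambda>(q, g). \<Psi> q g) (at (Q z, \<gamma> z)) (h b))) S"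
    for h
    unfolding riesz_def by (intro smooth_on_sum smooth_on_scaleR D smooth_on_const)
  have t: "smooth_on (\<lambda>z. transpose (f z)) S" if "smooth_on f S" for f :: "'a \<Rightarrow> mat3"
    by (rule smooth_on_bounded_linear[OF bounded_linear_transpose that])
  show "smooth_on (\<lambda>z. grad_Q \<Psi> (Q z) (\<gamma> z)) S"
    unfolding gradient_eq[OF diff] gradient_Q_def sym_part_def
    by (intro smooth_on_scaleR smooth_on_const smooth_on_add t r)
  show "smooth_on (\<lambda>z. grad_\<gamma> \<Psi> (Q z) (\<gamma> z) i) S"
    unfolding gradient_eq[OF diff] gradient_\<gamma>_def antisym_part_def vec_lambda_beta
    by (intro smooth_on_scaleR smooth_on_const smooth_on_diff t r)
qed

lemma grad_in_sym3_so3: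
  assumes "smooth_on (\<lambda>(q, g). \<Psi> q g) UNIV"
  shows "grad_Q \<Psi> Q \<gamma> \<in> sym3" "grad_\<gamma> \<Psi> Q \<gamma> i \<in> so3"
  using gradient_eq[OF smooth_on_imp_differentiable[OF assms]]
  by (simp_all add: gradient_Q_def gradient_\<gamma>_def sym_part_in_sym3 antisym_part_in_so3)

lemma frechet_derivative_eq_grad:
  assumes "smooth_on (\<lambda>(q, g). \<Psi> q g) UNIV" "dQ \<in> sym3" "\<And>i. d\<gamma> $ i \<in> so3"
  shows "frechet_derivative (\<lambda>(q, g). \<Psi> q g) (at (Q, \<gamma>)) (dQ, d\<gamma>)
           = grad_Q \<Psi> Q \<gamma> \<bullet> dQ + (\<Sum>i\<in>UNIV. grad_\<gamma> \<Psi> Q \<gamma> i \<bullet> d\<gamma> $ i)"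
  using gradient_eq[OF smooth_on_imp_differentiable[OF assms(1)], of Q \<gamma>]
    linear_decomposition_gradient[OF linear_frechet_derivative[OF smooth_on_imp_differentiable[OF assms(1)]] assms(2,3)]
  by simp

text \<open>After the substitution the energy is a polynomial in the entries of \<open>q\<close> and
  \<open>g\<close>.\<close>

lemma smooth_landau_de_gennes:
  "smooth_on (\<lambda>(q, g). landau_de_gennes \<alpha> L1 L2 \<beta> c P q (\<chi> k. commutator q (g $ k))) UNIV"
proof -
  have q: "smooth_on (\<lambda>p::mat3 \<times> mat3_triple. fst p $ i $ j) UNIV" for i j
    by (intro smooth_on_vec_nth smooth_on_fst smooth_on_ident)
  have g: "smooth_on (\<lambda>p::mat3 \<times> mat3_triple. commutator (fst p) (snd p $ k) $ i $ j) UNIV" for i j k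
    by (intro smooth_on_vec_nth smooth_on_bilinear[OF bounded_bilinear_commutator] smooth_on_fst
        smooth_on_snd smooth_on_ident)
  show ?thesis
    unfolding landau_de_gennes_def case_prod_unfold vec_lambda_beta power2_eq_square
    by (intro smooth_on_const q g smooth_on_add smooth_on_diff smooth_on_mult smooth_on_sum)
qed

lemma frechet_derivative_lagrangian:
  assumes "smooth_on (\<lambda>(q, g). \<Psi> q g) UNIV"
  shows "frechet_derivative (lagrangian J \<Psi>) (at (\<nu>, Q, \<gamma>)) (d\<nu>, dQ, d\<gamma>)
    = J * (commutator \<nu> Q \<bullet> (commutator d\<nu> Q + commutator \<nu> dQ))
      - frechet_derivative (\<lambda>(q, g). \<Psi> q g) (at (Q, \<gamma>)) (dQ, d\<gamma>)"
proof -
  let ?F = "\<lambda>(q, g). \<Psi> q g"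
  let ?D = "frechet_derivative ?F (at (Q, \<gamma>))"
  let ?p = "(\<nu>, Q, \<gamma>)"
  have "(?F has_derivative ?D) (at (snd ?p))"
    using smooth_on_imp_differentiable[OF assms] frechet_derivative_works by auto
  then have "((\<lambda>p. ?F (snd p)) has_derivative (\<lambda>v. ?D (snd v))) (at ?p)"
    by (intro has_derivative_compose[where g = ?F and f = snd] bounded_linear_imp_has_derivative
        bounded_linear_snd)
  moreover have C: "((\<lambda>p. commutator (fst p) (fst (snd p))) has_derivative
      (\<lambda>v. commutator (fst ?p) (fst (snd v)) + commutator (fst v) (fst (snd ?p)))) (at ?p)"
    by (intro comm.FDERIV has_derivative_fst has_derivative_snd has_derivative_ident)
  ultimately have "((\<lambda>p. J / 2 * (commutator (fst p) (fst (snd p)) \<bullet> commutator (fst p) (fst (snd p)))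
        - ?F (snd p)) has_derivative
      (\<lambda>v. J / 2 * (commutator (fst ?p) (fst (snd ?p)) \<bullet> (commutator (fst ?p) (fst (snd v)) + commutator (fst v) (fst (snd ?p)))
        + (commutator (fst ?p) (fst (snd v)) + commutator (fst v) (fst (snd ?p))) \<bullet> commutator (fst ?p) (fst (snd ?p)))
        - ?D (snd v))) (at ?p)"
    by (intro has_derivative_diff has_derivative_mult_right has_derivative_inner)
  moreover have "(\<lambda>p. J / 2 * (commutator (fst p) (fst (snd p)) \<bullet> commutator (fst p) (fst (snd p)))
        - ?F (snd p)) = lagrangian J \<Psi>"
    by (auto simp: lagrangian_def pairing_eq_inner fun_eq_iff)
  ultimately have "(lagrangian J \<Psi> has_derivative
      (\<lambda>v. J / 2 * (commutator \<nu> Q \<bullet> (commutator \<nu> (fst (snd v)) + commutator (fst v) Q)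
        + (commutator \<nu> (fst (snd v)) + commutator (fst v) Q) \<bullet> commutator \<nu> Q)
        - ?D (snd v))) (at ?p)" by simp
  from frechet_derivative_at[OF this, symmetric] show ?thesis
    by (simp add: inner_commute[of _ "commutator \<nu> Q"] inner_add_right algebra_simps)
qed

subsection \<open>The first variation\<close>

text \<open>The variational computation is separated from the rotation: it starts from smooth fields
  of the right symmetry types, which the main theorem provides from \<open>R\<close>.\<close>

locale moving_frame_fields =
  fixes J t1 t2 :: real
    and \<Psi> :: "mat3 \<Rightarrow> mat3_triple \<Rightarrow> real"
    and \<nu> Q :: "real^3 \<Rightarrow> real \<Rightarrow> mat3"
    and \<gamma> :: "real^3 \<Rightarrow> real \<Rightarrow> mat3_triple"
  assumes t12: "t1 < t2"
    and smooth_\<Psi>: "smooth_on (\<lambda>(q, g). \<Psi> q g) UNIV"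
    and smooth_\<nu>: "smooth_slab t1 t2 \<nu>"
    and smooth_Q: "smooth_slab t1 t2 Q"
    and smooth_\<gamma>: "smooth_slab t1 t2 \<gamma>"
    and \<nu>_so3: "t \<in> {t1..t2} \<Longrightarrow> \<nu> x t \<in> so3"
    and Q_sym3: "t \<in> {t1..t2} \<Longrightarrow> Q x t \<in> sym3"
    and \<gamma>_so3: "t \<in> {t1..t2} \<Longrightarrow> \<gamma> x t $ i \<in> so3"
begin

text \<open>Up to the factor \<open>J\<close> this is the momentum conjugate to
  \<open>\<nu>\<close>, the gradient of the kinetic term with respect to
  \<open>\<nu>\<close>.\<close>

definition p :: "real^3 \<Rightarrow> real \<Rightarrow> mat3" where
  "p x t = commutator (commutator (\<nu> x t) (Q x t)) (Q x t)"

definition G :: "3 \<Rightarrow> real^3 \<Rightarrow> real \<Rightarrow> mat3" where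
  "G i x t = grad_\<gamma> \<Psi> (Q x t) (\<gamma> x t) i"

definition N :: "real^3 \<Rightarrow> real \<Rightarrow> mat3" where
  "N x t = commutator (Q x t) (grad_Q \<Psi> (Q x t) (\<gamma> x t))
     + (\<Sum>i\<in>UNIV. commutator (G i x t) (\<gamma> x t $ i))"

definition euler_lagrange :: "real^3 \<Rightarrow> real \<Rightarrow> mat3" where
  "euler_lagrange x t = N x t - J *\<^sub>R time_deriv t1 t2 (p x) t
     - (\<Sum>i\<in>UNIV. partial i (\<lambda>y. G i y t) x)"

lemma smooth_p: "smooth_slab t1 t2 p"
  unfolding p_def
  by (intro smooth_on_bilinear[OF bounded_bilinear_commutator] smooth_\<nu> smooth_Q)

lemma smooth_G: "smooth_slab t1 t2 (G i)"
  unfolding G_def by (rule smooth_on_gradient(2)[OF smooth_\<Psi> smooth_Q smooth_\<gamma>])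

lemma smooth_N: "smooth_slab t1 t2 N"
  unfolding N_def
  by (intro smooth_on_add smooth_on_sum smooth_on_bilinear[OF bounded_bilinear_commutator]
      smooth_Q smooth_G smooth_on_vec_nth smooth_\<gamma> smooth_on_gradient(1)[OF smooth_\<Psi>])

lemma smooth_euler_lagrange: "smooth_slab t1 t2 euler_lagrange"
  unfolding euler_lagrange_def
  by (intro smooth_on_diff smooth_N smooth_on_scaleR smooth_on_const smooth_on_sum
      smooth_slab_derivs smooth_p smooth_G t12)

lemma p_so3: "t \<in> {t1..t2} \<Longrightarrow> p x t \<in> so3"
  unfolding p_def by (intro commutator_sym3_sym3 commutator_so3_sym3 \<nu>_so3 Q_sym3)

text \<open>Differentiate the linear identity \<open>f = - transpose f\<close> and use uniqueness of
  the derivative within the interval.\<close>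

lemma time_deriv_so3:
  assumes "smooth_slab t1 t2 f" "\<And>s. s \<in> {t1..t2} \<Longrightarrow> f x s \<in> so3" "t \<in> {t1..t2}"
  shows "time_deriv t1 t2 (f x) t \<in> so3"
proof -
  have "((\<lambda>s. - transpose (f x s)) has_vector_derivative - transpose (time_deriv t1 t2 (f x) t))
      (at t within {t1..t2})"
    by (intro has_vector_derivative_minus
        bounded_linear.has_vector_derivative[OF bounded_linear_transpose] has_time_deriv assms t12)
  then have "(f x has_vector_derivative - transpose (time_deriv t1 t2 (f x) t)) (at t within {t1..t2})"
    by (rule has_vector_derivative_transform[OF assms(3), rotated])
       (use assms(2) in \<open>auto simp: so3_def\<close>)
  from time_derivI[OF this t12 assms(3)] show ?thesis
    by (simp add: so3_def) (metis minus_minus)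
qed

lemma partial_so3:
  assumes "((\<lambda>r. f (x + r *\<^sub>R axis i 1)) has_vector_derivative partial i f x) (at 0)"
    and "\<And>y. f y \<in> so3"
  shows "partial i f x \<in> so3"
proof -
  have "((\<lambda>r. - transpose (f (x + r *\<^sub>R axis i 1))) has_vector_derivative - transpose (partial i f x)) (at 0)"
    by (intro has_vector_derivative_minus
        bounded_linear.has_vector_derivative[OF bounded_linear_transpose] assms)
  moreover have "- transpose (f y) = f y" for y using assms(2)[of y] by (simp add: so3_def)
  ultimately have "partial i f x = - transpose (partial i f x)" by (intro partialI) simp
  then show ?thesis by (simp add: so3_def) (metis minus_minus)
qed

lemma euler_lagrange_so3:
  assumes "t \<in> {t1..t2}"
  shows "euler_lagrange x t \<in> so3"
proof -
  have G: "G i y t \<in> so3" for i y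
    unfolding G_def by (rule grad_in_sym3_so3(2)[OF smooth_\<Psi>])
  have "N x t \<in> so3"
    unfolding N_def
    by (intro subspace_add subspace_sum subspace_so3 commutator_sym3_sym3 commutator_so3_so3
        Q_sym3 G \<gamma>_so3 assms grad_in_sym3_so3(1)[OF smooth_\<Psi>])
  then show ?thesis
    unfolding euler_lagrange_def
    by (intro subspace_diff subspace_sum subspace_scale subspace_so3
        time_deriv_so3[OF smooth_p p_so3 assms] partial_so3[OF has_partial_0[OF smooth_G t12 assms] G])
qed

text \<open>The indicator masks times outside \<open>{t1..t2}\<close>, where the fields carry no
  information. Admissibility puts \<open>K\<close> inside the open slab, so no boundary terms
  arise.\<close>

lemma first_variation_eq:
  assumes adm: "admissible_variation t1 t2 \<eta>"
  defines "K \<equiv> closure {(x, t). \<eta> x t \<noteq> 0}"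
  shows "first_variation J \<Psi> t1 t2 \<nu> Q \<gamma> \<eta>
    = (LINT z|lborel. indicator K z * (euler_lagrange (fst z) (snd z) \<bullet> \<eta> (fst z) (snd z)))"
proof -
  let ?\<eta> = "\<lambda>z. \<eta> (fst z) (snd z)"
  have \<eta>_smooth: "smooth_on ?\<eta> UNIV" and \<eta>_so3: "\<And>x t. \<eta> x t \<in> so3"
    and K: "compact K" "K \<subseteq> UNIV \<times> {t1<..<t2}"
    using adm by (auto simp: admissible_variation_def K_def case_prod_unfold)
  have K': "K \<subseteq> slab t1 t2" using K(2) by force
  have \<eta>0: "?\<eta> z = 0" if "z \<notin> K" for z
    using that closure_subset[of "{(x, t). \<eta> x t \<noteq> 0}"] by (auto simp: K_def case_prod_unfold)
  define \<eta>' where "\<eta>' = (\<lambda>z. frechet_derivative ?\<eta> (at z))"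
  have \<eta>': "(?\<eta> has_derivative \<eta>' z) (at z)" "continuous_on UNIV (\<lambda>z. \<eta>' z v)" for z v
    unfolding \<eta>'_def
    using smooth_on_imp_differentiable[OF \<eta>_smooth] frechet_derivative_works
      smooth_on_imp_continuous_on[OF smooth_on_frechet_derivative[OF \<eta>_smooth]] by blast+
  have \<eta>'0: "\<eta>' z v = 0" if "z \<notin> K" for z v
    using has_derivative_eq_0_off_support[OF \<eta>'(1) compact_imp_closed[OF K(1)] that \<eta>0] .
  have \<eta>s: "smooth_slab t1 t2 \<eta>" using smooth_on_subset[OF \<eta>_smooth] by blast
  have \<eta>'_eq: "time_deriv t1 t2 (\<eta> x) t = \<eta>' (x, t) (0, 1)"
    "partial i (\<lambda>y. \<eta> y t) x = \<eta>' (x, t) (axis i 1, 0)" if "t \<in> {t1..t2}" for x t i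
    using slab_derivative_directional_eq[of t1 t2 \<eta> \<eta>', OF has_derivative_at_withinI[OF \<eta>'(1)] that t12]
    by auto
  \<comment> \<open>The integrand with \<open>\<eta>\<close> moved out of all commutators. The
    gradient terms carry a plus sign because the minus before \<open>\<Psi>\<close> meets the minus
    before \<open>\<partial>\<^sub>i \<eta>\<close>.\<close>
  define h where "h = (\<lambda>z. J * (p (fst z) (snd z) \<bullet> \<eta>' z (0, 1)) + N (fst z) (snd z) \<bullet> ?\<eta> z
    + (\<Sum>i\<in>UNIV. G i (fst z) (snd z) \<bullet> \<eta>' z (axis i 1, 0)))"
  have integrand: "frechet_derivative (lagrangian J \<Psi>) (at (\<nu> x t, Q x t, \<gamma> x t))
          (time_deriv t1 t2 (\<eta> x) t + commutator (\<eta> x t) (\<nu> x t),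
           commutator (\<eta> x t) (Q x t),
           \<chi> i. commutator (\<eta> x t) (\<gamma> x t $ i) - partial i (\<lambda>y. \<eta> y t) x) = h (x, t)"
    if t: "t \<in> {t1..t2}" for x t
  proof -
    have d\<gamma>: "(\<chi> i. commutator (\<eta> x t) (\<gamma> x t $ i) - partial i (\<lambda>y. \<eta> y t) x) $ i \<in> so3" for i
      using subspace_diff[OF subspace_so3 commutator_so3_so3[OF \<eta>_so3 \<gamma>_so3[OF t]]
          partial_so3[OF has_partial_0[OF \<eta>s t12 t] \<eta>_so3]] by simp
    have "G i x t \<bullet> (commutator (\<eta> x t) (\<gamma> x t $ i) - partial i (\<lambda>y. \<eta> y t) x)
        = - (commutator (G i x t) (\<gamma> x t $ i) \<bullet> \<eta> x t + G i x t \<bullet> \<eta>' (x, t) (axis i 1, 0))" for i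
      using inner_commutator_so3[OF \<gamma>_so3[OF t]] by (simp add: inner_diff_right \<eta>'_eq[OF t])
    moreover have "grad_Q \<Psi> (Q x t) (\<gamma> x t) \<bullet> commutator (\<eta> x t) (Q x t)
        = - (commutator (Q x t) (grad_Q \<Psi> (Q x t) (\<gamma> x t)) \<bullet> \<eta> x t)"
      using inner_commutator_sym3[OF Q_sym3[OF t]] commutator_swap[of "Q x t"] by simp
    ultimately show ?thesis
      unfolding frechet_derivative_lagrangian[OF smooth_\<Psi>]
        kinetic_variation[OF \<nu>_so3[OF t] Q_sym3[OF t]]
        frechet_derivative_eq_grad[OF smooth_\<Psi> commutator_so3_sym3[OF \<eta>_so3 Q_sym3[OF t]] d\<gamma>]
      by (simp add: h_def N_def p_def G_def[symmetric] \<eta>'_eq[OF t] inner_add_left inner_sum_left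
          sum.distrib sum_subtractf sum_negf)
  qed
  note cont = smooth_on_imp_continuous_on[OF smooth_p] smooth_on_imp_continuous_on[OF smooth_N]
    smooth_on_imp_continuous_on[OF smooth_G] smooth_on_imp_continuous_on[OF \<eta>s]
    smooth_on_imp_continuous_on[OF smooth_euler_lagrange]
    smooth_on_imp_continuous_on[OF smooth_slab_derivs(1)[OF smooth_p t12]]
    smooth_on_imp_continuous_on[OF smooth_slab_derivs(2)[OF smooth_G t12]]
    continuous_on_subset[OF \<eta>'(2) subset_UNIV]
  have "first_variation J \<Psi> t1 t2 \<nu> Q \<gamma> \<eta> = (LINT t:{t1..t2}|lborel. LINT x|lborel. h (x, t))"
    unfolding first_variation_def
    by (rule set_lebesgue_integral_cong) (simp_all add: integrand)
  also have "\<dots> = (LINT z|lborel. indicator K z * h z)"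
  proof (rule slab_iterated_integral[OF K(1) K'])
    show "continuous_on (slab t1 t2) h"
      unfolding h_def by (intro continuous_intros cont)
    show "h z = 0" if "z \<notin> K" for z using \<eta>0[OF that] \<eta>'0[OF that] by (simp add: h_def)
  qed
  also have "\<dots> = (LINT z|lborel. indicator K z * (euler_lagrange (fst z) (snd z) \<bullet> ?\<eta> z))"
  proof -
    \<comment> \<open>\<open>pt\<close> and \<open>gi\<close> are the product-rule derivatives of
      \<open>p \<bullet> \<eta>\<close> and \<open>G i \<bullet> \<eta>\<close>, cut off to
      \<open>K\<close>. Adding \<open>J * pt\<close> and all \<open>gi\<close> to the Euler-Lagrange
      integrand \<open>e\<close> restores \<open>h\<close>, and each of them integrates to
      \<open>0\<close>.\<close>
    define pt :: "(real^3) \<times> real \<Rightarrow> real"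
      where "pt = (\<lambda>z. indicator K z * (time_deriv t1 t2 (p (fst z)) (snd z) \<bullet> ?\<eta> z
        + p (fst z) (snd z) \<bullet> \<eta>' z (0, 1)))"
    define gi :: "3 \<Rightarrow> (real^3) \<times> real \<Rightarrow> real"
      where "gi = (\<lambda>i z. indicator K z * (partial i (\<lambda>y. G i y (snd z)) (fst z) \<bullet> ?\<eta> z
        + G i (fst z) (snd z) \<bullet> \<eta>' z (axis i 1, 0)))"
    have int: "integrable lborel (\<lambda>z. indicator K z * f z)" if "continuous_on (slab t1 t2) f"
      for f :: "(real^3) \<times> real \<Rightarrow> real"
      using borel_integrable_compact[OF K(1) continuous_on_subset[OF that K']] by simp
    define e :: "(real^3) \<times> real \<Rightarrow> real"
      where "e = (\<lambda>z. indicator K z * (euler_lagrange (fst z) (snd z) \<bullet> ?\<eta> z))"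
    have "(\<lambda>z. indicator K z * h z) = (\<lambda>z. e z + J * pt z + (\<Sum>i\<in>UNIV. gi i z))"
      by (simp add: e_def pt_def gi_def fun_eq_iff h_def euler_lagrange_def inner_diff_left inner_sum_left sum.distrib
          sum_distrib_left algebra_simps)
    moreover have "integral\<^sup>L lborel pt = 0"
    proof (rule smooth_slab_has_derivative[OF smooth_p t12])
      fix p'
      assume p': "\<And>z. z \<in> slab t1 t2 \<Longrightarrow> ((\<lambda>z. p (fst z) (snd z)) has_derivative p' z) (at z within slab t1 t2)"
        "\<And>v. continuous_on (slab t1 t2) (\<lambda>z. p' z v)"
        "\<And>x t. t \<in> {t1..t2} \<Longrightarrow> p' (x, t) (0, 1) = time_deriv t1 t2 (p x) t"
      \<comment> \<open>The total derivative \<open>p'\<close> agrees with \<open>time_deriv\<close>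
        on the slab only; the indicator hides the remaining points.\<close>
      have "pt = (\<lambda>z. indicator K z * (p' z (0, 1) \<bullet> ?\<eta> z + p (fst z) (snd z) \<bullet> \<eta>' z (0, 1)))"
        using K' p'(3) by (fastforce simp: pt_def indicator_def)
      then show ?thesis
        using slab_integration_by_parts[OF p'(1,2) \<eta>' K \<eta>0] by simp
    qed
    moreover have "integral\<^sup>L lborel (gi i) = 0" for i
    proof (rule smooth_slab_has_derivative[OF smooth_G t12])
      fix G'
      assume G': "\<And>z. z \<in> slab t1 t2 \<Longrightarrow> ((\<lambda>z. G i (fst z) (snd z)) has_derivative G' z) (at z within slab t1 t2)"
        "\<And>v. continuous_on (slab t1 t2) (\<lambda>z. G' z v)"
        "\<And>x t j. t \<in> {t1..t2} \<Longrightarrow> G' (x, t) (axis j 1, 0) = partial j (\<lambda>y. G i y t) x"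
      have "gi i = (\<lambda>z. indicator K z * (G' z (axis i 1, 0) \<bullet> ?\<eta> z
          + G i (fst z) (snd z) \<bullet> \<eta>' z (axis i 1, 0)))"
        using K' G'(3) by (fastforce simp: gi_def indicator_def)
      then show ?thesis
        using slab_integration_by_parts[OF G'(1,2) \<eta>' K \<eta>0] by simp
    qed
    moreover have "integrable lborel e" "integrable lborel pt" "\<And>i. integrable lborel (gi i)"
      unfolding e_def pt_def gi_def by (intro int continuous_intros cont)+
    ultimately show ?thesis unfolding e_def[symmetric] by simp
  qed
  finally show ?thesis .
qed

lemma stationary_iff_euler_lagrange:
  "(\<forall>\<eta>. admissible_variation t1 t2 \<eta> \<longrightarrow> first_variation J \<Psi> t1 t2 \<nu> Q \<gamma> \<eta> = 0)
    \<longleftrightarrow> (\<forall>x. \<forall>t\<in>{t1..t2}. euler_lagrange x t = 0)"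
proof (intro iffI allI impI ballI)
  fix \<eta> assume E: "\<forall>x. \<forall>t\<in>{t1..t2}. euler_lagrange x t = 0" and adm: "admissible_variation t1 t2 \<eta>"
  let ?K = "closure {(x, t). \<eta> x t \<noteq> 0}"
  have "indicator ?K z * (euler_lagrange (fst z) (snd z) \<bullet> \<eta> (fst z) (snd z)) = 0" for z
  proof (cases "z \<in> ?K")
    case True
    then have "snd z \<in> {t1..t2}" using adm by (fastforce simp: admissible_variation_def)
    then show ?thesis using E by simp
  qed simp
  then show "first_variation J \<Psi> t1 t2 \<nu> Q \<gamma> \<eta> = 0"
    by (simp only: first_variation_eq[OF adm]) simp
next
  fix x t
  assume stat: "\<forall>\<eta>. admissible_variation t1 t2 \<eta> \<longrightarrow> first_variation J \<Psi> t1 t2 \<nu> Q \<gamma> \<eta> = 0"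
    and t: "t \<in> {t1..t2}"
  let ?O = "UNIV \<times> {t1<..<t2} :: ((real^3) \<times> real) set"
  let ?E = "\<lambda>z. euler_lagrange (fst z) (snd z)"
  have O: "open ?O" by (intro open_Times) auto
  have cont: "continuous_on (slab t1 t2) ?E" by (rule smooth_on_imp_continuous_on[OF smooth_euler_lagrange])
  have interior: "?E z0 = 0" if z0: "z0 \<in> ?O" for z0
  proof (rule ccontr)
    assume ne: "?E z0 \<noteq> 0"
    have cE: "continuous_on ?O (\<lambda>z. ?E z \<bullet> ?E z0)"
      by (intro continuous_intros continuous_on_subset[OF cont]) auto
    have "open (?O \<inter> (\<lambda>z. ?E z \<bullet> ?E z0) -` {0<..})"
      by (rule continuous_open_preimage[OF cE O open_greaterThan])
    moreover have "z0 \<in> ?O \<inter> (\<lambda>z. ?E z \<bullet> ?E z0) -` {0<..}" using z0 ne by simp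
    \<comment> \<open>A closed ball is chosen because the support of the test field is the closure
      of the open ball and has to stay inside the open slab.\<close>
    ultimately obtain r where r: "r > 0" "cball z0 r \<subseteq> ?O \<inter> (\<lambda>z. ?E z \<bullet> ?E z0) -` {0<..}"
      using open_contains_cball by blast
    obtain \<phi> :: "(real^3) \<times> real \<Rightarrow> real" where
      \<phi>: "smooth_on \<phi> UNIV" "\<And>z. \<phi> z \<ge> 0" "\<And>z. \<phi> z > 0 \<longleftrightarrow> z \<in> ball z0 r"
      using smooth_bump_exists[OF r(1)] by blast
    define \<eta> where "\<eta> = (\<lambda>x t. \<phi> (x, t) *\<^sub>R ?E z0)"
    let ?K = "closure {(x, t). \<eta> x t \<noteq> 0}"
    have "{(x, t). \<eta> x t \<noteq> 0} = ball z0 r"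
      using \<phi>(2,3) ne by (auto simp: \<eta>_def less_le)
    then have K: "?K = cball z0 r" using r(1) by simp
    have "?E z0 \<in> so3" using z0 by (intro euler_lagrange_so3) auto
    then have adm: "admissible_variation t1 t2 \<eta>"
      unfolding admissible_variation_def K
      using r(2) subspace_scale[OF subspace_so3]
      by (auto simp: \<eta>_def case_prod_unfold intro!: smooth_on_scaleR smooth_on_const \<phi>(1))
    define F where "F = (\<lambda>z. indicator ?K z * (?E z \<bullet> \<eta> (fst z) (snd z)))"
    \<comment> \<open>Both forms of \<open>F\<close> are used: this one for continuity on the closed
      ball and for the value at \<open>z0\<close>, the one with the indicator for
      \<open>F z = 0\<close> off the ball, where the sign of \<open>?E z \<bullet> ?E z0\<close> is
      unknown.\<close>
    have F: "F z = \<phi> z * (?E z \<bullet> ?E z0)" for z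
    proof (cases "z \<in> ball z0 r")
      case False
      then have "\<not> \<phi> z > 0" using \<phi>(3) by blast
      then have "\<phi> z = 0" using \<phi>(2)[of z] by linarith
      then show ?thesis by (simp add: F_def \<eta>_def)
    next
      case True
      then have "indicator ?K z = (1::real)" unfolding K by simp
      then have "F z = ?E z \<bullet> \<eta> (fst z) (snd z)" by (simp add: F_def)
      then show ?thesis by (simp add: \<eta>_def)
    qed
    have "F z0 = 0"
    proof (rule nonneg_integral_eq_0_imp_eq_0_on_open[where h = F and U = "ball z0 r"])
      show "integral\<^sup>L lborel F = 0"
        using stat adm first_variation_eq[OF adm] by (simp add: F_def)
      have sub: "cball z0 r \<subseteq> slab t1 t2" using r(2) by force
      have c: "continuous_on UNIV \<phi>" by (rule smooth_on_imp_continuous_on[OF \<phi>(1)])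
      have cF: "continuous_on (cball z0 r) F"
        unfolding F by (intro continuous_intros continuous_on_subset[OF c] continuous_on_subset[OF cont sub]) simp
      show "integrable lborel F"
        by (rule integrable_lborel_compact_support[OF compact_cball cF]) (simp add: F_def K)
      show "continuous_on (ball z0 r) F" by (rule continuous_on_subset[OF cF]) auto
      show "0 \<le> F z" for z
      proof (cases "z \<in> cball z0 r")
        case True
        then have "?E z \<bullet> ?E z0 > 0" using r(2) by auto
        then show ?thesis using \<phi>(2) by (simp add: F)
      qed (simp add: F_def K)
    qed (use r(1) in auto)
    moreover have "\<phi> z0 > 0" using \<phi>(3) r(1) by simp
    ultimately show False using ne by (simp add: F)
  qed
  have closure: "closure ?O = slab t1 t2"
    using t12 by (simp add: closure_Times)
  have "?E (x, t) = 0"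
    by (rule continuous_constant_on_closure[where S = ?O]) (use cont interior closure t in auto)
  then show "euler_lagrange x t = 0" by simp
qed

end

subsection \<open>Fields generated by a rotation\<close>

lemma partial_matrix_mult:
  fixes f g :: "real^3 \<Rightarrow> real \<Rightarrow> mat3"
  assumes "smooth_slab t1 t2 f" "smooth_slab t1 t2 g" "t1 < t2" "t \<in> {t1..t2}"
  shows "partial i (\<lambda>y. f y t ** g y t) x
    = f x t ** partial i (\<lambda>y. g y t) x + partial i (\<lambda>y. f y t) x ** g x t"
  using matmul.has_vector_derivative[OF has_partial_0[OF assms(1,3,4)] has_partial_0[OF assms(2,3,4)]]
  by (intro partialI) simp

lemma time_deriv_matrix_mult:
  fixes f g :: "real^3 \<Rightarrow> real \<Rightarrow> mat3"
  assumes "smooth_slab t1 t2 f" "smooth_slab t1 t2 g" "t1 < t2" "t \<in> {t1..t2}"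
  shows "time_deriv t1 t2 (\<lambda>s. f x s ** g x s) t
    = f x t ** time_deriv t1 t2 (g x) t + time_deriv t1 t2 (f x) t ** g x t"
  by (rule time_derivI[OF matmul.has_vector_derivative[OF has_time_deriv[OF assms(1,3,4)]
        has_time_deriv[OF assms(2,3,4)]] assms(3,4)])

lemma partial_transpose:
  fixes f :: "real^3 \<Rightarrow> real \<Rightarrow> mat3"
  assumes "smooth_slab t1 t2 f" "t1 < t2" "t \<in> {t1..t2}"
  shows "partial i (\<lambda>y. transpose (f y t)) x = transpose (partial i (\<lambda>y. f y t) x)"
  by (rule partialI[OF bounded_linear.has_vector_derivative[OF bounded_linear_transpose
        has_partial_0[OF assms]]])

lemma time_deriv_transpose:
  fixes f :: "real^3 \<Rightarrow> real \<Rightarrow> mat3"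
  assumes "smooth_slab t1 t2 f" "t1 < t2" "t \<in> {t1..t2}"
  shows "time_deriv t1 t2 (\<lambda>s. transpose (f x s)) t = transpose (time_deriv t1 t2 (f x) t)"
  by (rule time_derivI[OF bounded_linear.has_vector_derivative[OF bounded_linear_transpose
        has_time_deriv[OF assms]] assms(2,3)])

text \<open>\<open>Q\<close>, \<open>\<nu>\<close> and \<open>\<gamma>\<close> are prescribed only
  for times in \<open>{t1..t2}\<close>; a derivative within the interval sees nothing else, even at
  the endpoints.\<close>

lemma time_deriv_cong:
  fixes f g :: "real \<Rightarrow> 'b::euclidean_space"
  assumes "\<And>s. s \<in> {t1..t2} \<Longrightarrow> f s = g s" "t \<in> {t1..t2}"
  shows "time_deriv t1 t2 f t = time_deriv t1 t2 g t"
proof -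
  have "(f has_vector_derivative d) (at t within {t1..t2})
      \<longleftrightarrow> (g has_vector_derivative d) (at t within {t1..t2})" for d
    using has_vector_derivative_transform[OF assms(2), of f g d]
      has_vector_derivative_transform[OF assms(2), of g f d] assms(1) by auto
  then show ?thesis by (simp add: time_deriv_def vector_derivative_def)
qed

text \<open>\<open>matrix_inv\<close> chooses some two-sided inverse; multiplying
  \<open>A ** B = mat 1\<close> by \<open>transpose A\<close> from the left shows that there is only
  one to choose.\<close>

lemma rotation_matrix_inv:
  fixes A :: mat3
  assumes "rotation_matrix A"
  shows "A ** transpose A = mat 1" "transpose A ** A = mat 1" "matrix_inv A = transpose A"
proof -
  show *: "A ** transpose A = mat 1" "transpose A ** A = mat 1"
    using assms by (simp_all add: rotation_matrix_def orthogonal_matrix_def)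
  have unique: "B = transpose A" if "A ** B = mat 1" for B
  proof -
    have "transpose A ** (A ** B) = transpose A" by (simp add: that)
    then show ?thesis by (simp add: matrix_mul_assoc *)
  qed
  show "matrix_inv A = transpose A"
    unfolding matrix_inv_def by (rule some_equality) (simp add: *, rule unique, simp)
qed

theorem mainTheorem2:
  fixes J \<alpha> L1 L2 \<beta> c P t1 t2 :: real
    and Q0 :: "real^3 \<Rightarrow> mat3"
    and \<gamma>0 :: "real^3 \<Rightarrow> mat3_triple"
    and R Q \<nu> :: "real^3 \<Rightarrow> real \<Rightarrow> mat3"
    and \<gamma> :: "real^3 \<Rightarrow> real \<Rightarrow> mat3_triple"
    and \<Psi> :: "mat3 \<Rightarrow> mat3_triple \<Rightarrow> real"
  assumes "J > 0" and "P \<noteq> 0" and "t1 < t2"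
    and "smooth_on Q0 UNIV" and "\<And>x. Q0 x \<in> sym0_3"
    and "smooth_on \<gamma>0 UNIV" and "\<And>x i. \<gamma>0 x $ i \<in> so3"
    and "\<And>x i. partial i Q0 x = commutator (Q0 x) (\<gamma>0 x $ i)"
    and "smooth_on (\<lambda>(x, t). R x t) (UNIV \<times> {t1..t2})"
    and "\<And>x t. t \<in> {t1..t2} \<Longrightarrow> rotation_matrix (R x t)"
    and "\<And>x t. t \<in> {t1..t2} \<Longrightarrow> Q x t = R x t ** Q0 x ** transpose (R x t)"
    and "\<And>x t. t \<in> {t1..t2} \<Longrightarrow> \<nu> x t = time_deriv t1 t2 (R x) t ** matrix_inv (R x t)"
    and "\<And>x t i. t \<in> {t1..t2} \<Longrightarrow>
           \<gamma> x t $ i = - (partial i (\<lambda>y. R y t) x ** matrix_inv (R x t))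
                       + R x t ** \<gamma>0 x $ i ** matrix_inv (R x t)"
    and "\<And>q g. \<Psi> q g = landau_de_gennes \<alpha> L1 L2 \<beta> c P q (\<chi> k. commutator q (g $ k))"
  shows "(\<forall>x. \<forall>t\<in>{t1..t2}. \<forall>i.
            partial i (\<lambda>y. Q y t) x = commutator (Q x t) (\<gamma> x t $ i)) \<and>
         (\<forall>x. \<forall>t\<in>{t1..t2}.
            time_deriv t1 t2 (Q x) t = commutator (\<nu> x t) (Q x t)) \<and>
         (\<forall>x. \<forall>t\<in>{t1..t2}. \<forall>i.
            time_deriv t1 t2 (\<lambda>s. \<gamma> x s $ i) t
              = commutator (\<nu> x t) (\<gamma> x t $ i) - partial i (\<lambda>y. \<nu> y t) x) \<and>
         ((\<forall>\<eta>. admissible_variation t1 t2 \<eta> \<longrightarrow> first_variation J \<Psi> t1 t2 \<nu> Q \<gamma> \<eta> = 0)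
          \<longleftrightarrow>
          (\<forall>x. \<forall>t\<in>{t1..t2}.
             J *\<^sub>R time_deriv t1 t2 (\<lambda>s. commutator (commutator (\<nu> x s) (Q x s)) (Q x s)) t
               = commutator (Q x t) (grad_Q \<Psi> (Q x t) (\<gamma> x t))
                 + (\<Sum>i\<in>UNIV. commutator (grad_\<gamma> \<Psi> (Q x t) (\<gamma> x t) i) (\<gamma> x t $ i))
                 - (\<Sum>i\<in>UNIV. partial i (\<lambda>y. grad_\<gamma> \<Psi> (Q y t) (\<gamma> y t) i) x)))"
proof -
  note t12 = \<open>t1 < t2\<close>
  define Rt where "Rt = (\<lambda>x. time_deriv t1 t2 (R x))"
  define Rx where "Rx = (\<lambda>i x t. partial i (\<lambda>y. R y t) x)"
  \<comment> \<open>The spatial counterpart of \<open>\<nu>\<close>: \<open>Rx i = W i ** R\<close>,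
    just as \<open>Rt = \<nu> ** R\<close>, and \<open>- W i\<close> is the inhomogeneous part of
    \<open>\<gamma>\<close>.\<close>
  define W where "W = (\<lambda>i x t. Rx i x t ** transpose (R x t))"
  have R: "smooth_slab t1 t2 R" using assms(9) by (simp add: case_prod_unfold)
  have RT: "smooth_slab t1 t2 (\<lambda>x t. transpose (R x t))"
    by (rule smooth_on_bounded_linear[OF bounded_linear_transpose R])
  have Q0: "smooth_slab t1 t2 (\<lambda>x t. Q0 x)"
    by (rule smooth_on_compose[OF assms(4)]) (intro smooth_on_fst smooth_on_ident)
  have \<gamma>0: "smooth_slab t1 t2 (\<lambda>x t. \<gamma>0 x $ i)" for i
    by (intro smooth_on_vec_nth smooth_on_compose[OF assms(6)] smooth_on_fst smooth_on_ident)
  have Rt: "smooth_slab t1 t2 Rt" unfolding Rt_def by (rule smooth_slab_derivs(1)[OF R t12])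
  have Rx: "smooth_slab t1 t2 (Rx i)" for i unfolding Rx_def by (rule smooth_slab_derivs(2)[OF R t12])
  note mult = smooth_on_bilinear[OF bounded_bilinear_matrix_mult]
  note rot = rotation_matrix_inv[OF assms(10)]
  \<comment> \<open>Stated with a leading factor \<open>A\<close> because
    \<open>matrix_algebra\<close> nests products to the left.\<close>
  have cancel [simp]: "A ** R x t ** transpose (R x t) = A" "A ** transpose (R x t) ** R x t = A"
    if "t \<in> {t1..t2}" for A x t
    using rot[OF that] by (simp_all add: matrix_mul_assoc[symmetric])
  have Q_eq: "Q x t = R x t ** Q0 x ** transpose (R x t)" if "t \<in> {t1..t2}" for x t
    by (rule assms(11)[OF that])
  have \<nu>_eq: "\<nu> x t = Rt x t ** transpose (R x t)" if "t \<in> {t1..t2}" for x t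
    using assms(12)[OF that] rot(3)[OF that] by (simp add: Rt_def)
  have \<gamma>_eq: "\<gamma> x t $ i = - W i x t + R x t ** \<gamma>0 x $ i ** transpose (R x t)" if "t \<in> {t1..t2}" for x t i
    using assms(13)[OF that] rot(3)[OF that] by (simp add: Rx_def W_def)
  have Rt_eq: "Rt x t = \<nu> x t ** R x t" if "t \<in> {t1..t2}" for x t
    using that by (simp add: \<nu>_eq)
  have Rx_eq: "Rx i x t = W i x t ** R x t" if "t \<in> {t1..t2}" for x t i
    using that by (simp add: W_def)

  \<comment> \<open>Regularity of the rotated fields on the slab\<close>
  have smooth_Q: "smooth_slab t1 t2 Q"
    by (rule smooth_on_cong[OF mult[OF mult[OF R Q0] RT]]) (auto simp: Q_eq)
  have smooth_\<nu>: "smooth_slab t1 t2 \<nu>"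
    by (rule smooth_on_cong[OF mult[OF Rt RT]]) (auto simp: \<nu>_eq)
  have smooth_\<gamma>i: "smooth_slab t1 t2 (\<lambda>x t. \<gamma> x t $ i)" for i
    by (rule smooth_on_cong[OF smooth_on_add[OF smooth_on_minus[OF mult[OF Rx RT]] mult[OF mult[OF R \<gamma>0] RT]]])
       (auto simp: \<gamma>_eq W_def)
  have smooth_\<gamma>: "smooth_slab t1 t2 \<gamma>"
    using smooth_on_vec_lambda[of "\<lambda>i z. \<gamma> (fst z) (snd z) $ i", OF smooth_\<gamma>i] by simp

  \<comment> \<open>Symmetry types of the fields\<close>
  have \<nu>_so3: "\<nu> x t \<in> so3" if t: "t \<in> {t1..t2}" for x t
  proof -
    have "time_deriv t1 t2 (\<lambda>s. R x s ** transpose (R x s)) t = time_deriv t1 t2 (\<lambda>_. mat 1) t"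
      by (rule time_deriv_cong[OF rot(1) t])
    also have "\<dots> = 0" by (intro time_derivI has_vector_derivative_const t12 t)
    finally have "R x t ** transpose (Rt x t) + Rt x t ** transpose (R x t) = 0"
      by (simp add: time_deriv_matrix_mult[OF R RT t12 t] time_deriv_transpose[OF R t12 t] Rt_def)
    then show ?thesis
      by (simp add: so3_def \<nu>_eq[OF t] transpose_algebra eq_neg_iff_add_eq_0)
  qed
  have W_so3: "W i x t \<in> so3" if t: "t \<in> {t1..t2}" for x t i
  proof -
    have "partial i (\<lambda>y. R y t ** transpose (R y t)) x = partial i (\<lambda>_. mat 1) x"
      using rot(1)[OF t] by simp
    also have "\<dots> = 0" by (intro partialI has_vector_derivative_const)
    finally have "R x t ** transpose (Rx i x t) + Rx i x t ** transpose (R x t) = 0"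
      by (simp add: partial_matrix_mult[OF R RT t12 t] partial_transpose[OF R t12 t] Rx_def)
    then show ?thesis
      by (simp add: so3_def W_def transpose_algebra eq_neg_iff_add_eq_0)
  qed
  have \<gamma>_so3: "\<gamma> x t $ i \<in> so3" if t: "t \<in> {t1..t2}" for x t i
    using W_so3[OF t, of i x] assms(7)[of x i]
    by (simp add: \<gamma>_eq[OF t] so3_def transpose_algebra matrix_algebra)
  have Q_sym3: "Q x t \<in> sym3" if t: "t \<in> {t1..t2}" for x t
    using assms(5)[of x] by (simp add: Q_eq[OF t] sym3_def sym0_3_def transpose_algebra matrix_algebra)
  \<comment> \<open>Antisymmetry of \<open>\<nu>\<close> moves the transpose off \<open>Rt\<close>.
    All derivatives of \<open>R\<close> can then be eliminated in favour of \<open>\<nu>\<close> and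
    \<open>W\<close>, which leaves pure matrix algebra.\<close>
  have RtT: "transpose (Rt x t) = - (transpose (R x t) ** \<nu> x t)" if t: "t \<in> {t1..t2}" for x t
    using \<nu>_so3[OF t, of x] by (simp add: Rt_eq[OF t] transpose_algebra so3_def matrix_algebra)
  have RxT: "transpose (Rx i x t) = - (transpose (R x t) ** W i x t)" if t: "t \<in> {t1..t2}" for x t i
    using W_so3[OF t, of i x] by (simp add: Rx_eq[OF t] transpose_algebra so3_def matrix_algebra)

  \<comment> \<open>Kinematic identities for \<open>Q\<close> and \<open>\<gamma>\<close>\<close>
  have dxQ: "partial i (\<lambda>y. Q y t) x = commutator (Q x t) (\<gamma> x t $ i)" if t: "t \<in> {t1..t2}" for x t i
  proof -
    have "partial i (\<lambda>y. Q y t) x = partial i (\<lambda>y. R y t ** Q0 y ** transpose (R y t)) x"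
      by (simp add: Q_eq[OF t])
    also have "\<dots> = R x t ** Q0 x ** transpose (Rx i x t)
        + (R x t ** commutator (Q0 x) (\<gamma>0 x $ i) + Rx i x t ** Q0 x) ** transpose (R x t)"
      by (simp add: partial_matrix_mult[OF mult[OF R Q0] RT t12 t] partial_matrix_mult[OF R Q0 t12 t]
          partial_transpose[OF R t12 t] Rx_def assms(8))
    also have "\<dots> = commutator (Q x t) (\<gamma> x t $ i)"
      \<comment> \<open>The transposed derivative is rewritten first: \<open>Rx_eq\<close> would
        otherwise expand the \<open>Rx\<close> under the transpose.\<close>
      unfolding RxT[OF t] unfolding Rx_eq[OF t] Q_eq[OF t] \<gamma>_eq[OF t] commutator_def
      using t by (simp add: matrix_algebra algebra_simps)
    finally show ?thesis .
  qed
  have dtQ: "time_deriv t1 t2 (Q x) t = commutator (\<nu> x t) (Q x t)" if t: "t \<in> {t1..t2}" for x t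
  proof -
    have "time_deriv t1 t2 (Q x) t = time_deriv t1 t2 (\<lambda>s. R x s ** Q0 x ** transpose (R x s)) t"
      by (rule time_deriv_cong[OF Q_eq t])
    also have "\<dots> = R x t ** Q0 x ** transpose (Rt x t) + Rt x t ** Q0 x ** transpose (R x t)"
      by (simp add: time_deriv_matrix_mult[OF mult[OF R Q0] RT t12 t] time_deriv_matrix_mult[OF R Q0 t12 t]
          time_deriv_transpose[OF R t12 t] Rt_def time_derivI[OF has_vector_derivative_const t12 t])
    also have "\<dots> = commutator (\<nu> x t) (Q x t)"
      unfolding RtT[OF t] unfolding Rt_eq[OF t] Q_eq[OF t] commutator_def
      using t by (simp add: matrix_algebra algebra_simps)
    finally show ?thesis .
  qed
  have dt\<gamma>: "time_deriv t1 t2 (\<lambda>s. \<gamma> x s $ i) t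
      = commutator (\<nu> x t) (\<gamma> x t $ i) - partial i (\<lambda>y. \<nu> y t) x" if t: "t \<in> {t1..t2}" for x t i
  proof -
    \<comment> \<open>Exchanging the derivatives gives
      \<open>\<partial>\<^sub>i (\<nu> ** R)\<close>, whose product rule is the source of the term
      \<open>\<partial>\<^sub>i \<nu>\<close> in the evolution of \<open>\<gamma>\<close>.\<close>
    have "time_deriv t1 t2 (Rx i x) t = partial i (\<lambda>y. Rt y t) x"
      unfolding Rx_def Rt_def by (rule time_deriv_partial_commute[OF R t12 t])
    also have "\<dots> = partial i (\<lambda>y. \<nu> y t ** R y t) x" by (simp add: Rt_eq[OF t])
    also have "\<dots> = \<nu> x t ** Rx i x t + partial i (\<lambda>y. \<nu> y t) x ** R x t"
      by (simp add: partial_matrix_mult[OF smooth_\<nu> R t12 t] Rx_def)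
    finally have dtRx: "time_deriv t1 t2 (Rx i x) t = \<nu> x t ** Rx i x t + partial i (\<lambda>y. \<nu> y t) x ** R x t" .
    have "time_deriv t1 t2 (\<lambda>s. \<gamma> x s $ i) t = time_deriv t1 t2
        (\<lambda>s. - (Rx i x s ** transpose (R x s)) + R x s ** \<gamma>0 x $ i ** transpose (R x s)) t"
      by (rule time_deriv_cong[OF _ t]) (simp add: \<gamma>_eq W_def)
    also have "\<dots> = - time_deriv t1 t2 (\<lambda>s. Rx i x s ** transpose (R x s)) t
        + time_deriv t1 t2 (\<lambda>s. R x s ** \<gamma>0 x $ i ** transpose (R x s)) t"
      by (intro time_derivI has_vector_derivative_add has_vector_derivative_minus t12 t
          has_time_deriv[OF mult[OF Rx RT]] has_time_deriv[OF mult[OF mult[OF R \<gamma>0] RT]])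
    also have "\<dots> = - (Rx i x t ** transpose (Rt x t) + time_deriv t1 t2 (Rx i x) t ** transpose (R x t))
        + (R x t ** \<gamma>0 x $ i ** transpose (Rt x t) + Rt x t ** \<gamma>0 x $ i ** transpose (R x t))"
      by (simp add: time_deriv_matrix_mult[OF mult[OF R \<gamma>0] RT t12 t] time_deriv_matrix_mult[OF R \<gamma>0 t12 t]
          time_deriv_matrix_mult[OF Rx RT t12 t]
          time_deriv_transpose[OF R t12 t] Rt_def time_derivI[OF has_vector_derivative_const t12 t])
    also have "\<dots> = commutator (\<nu> x t) (\<gamma> x t $ i) - partial i (\<lambda>y. \<nu> y t) x"
      unfolding dtRx RtT[OF t] unfolding Rt_eq[OF t] Rx_eq[OF t] \<gamma>_eq[OF t] commutator_def
      using t by (simp add: matrix_algebra algebra_simps)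
    finally show ?thesis .
  qed

  \<comment> \<open>The variational principle for the rotated fields\<close>
  have \<Psi>: "\<Psi> = (\<lambda>q g. landau_de_gennes \<alpha> L1 L2 \<beta> c P q (\<chi> k. commutator q (g $ k)))"
    using assms(14) by (simp add: fun_eq_iff)
  interpret moving_frame_fields J t1 t2 \<Psi> \<nu> Q \<gamma>
    by unfold_locales
       (use t12 smooth_landau_de_gennes smooth_\<nu> smooth_Q smooth_\<gamma> \<nu>_so3 Q_sym3 \<gamma>_so3 in \<open>auto simp: \<Psi>\<close>)
  have "euler_lagrange x t = 0 \<longleftrightarrow>
      J *\<^sub>R time_deriv t1 t2 (\<lambda>s. commutator (commutator (\<nu> x s) (Q x s)) (Q x s)) t
        = commutator (Q x t) (grad_Q \<Psi> (Q x t) (\<gamma> x t))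
          + (\<Sum>i\<in>UNIV. commutator (grad_\<gamma> \<Psi> (Q x t) (\<gamma> x t) i) (\<gamma> x t $ i))
          - (\<Sum>i\<in>UNIV. partial i (\<lambda>y. grad_\<gamma> \<Psi> (Q y t) (\<gamma> y t) i) x)" for x t
    unfolding euler_lagrange_def N_def G_def p_def by (auto simp: algebra_simps)
  then show ?thesis
    using dxQ dtQ dt\<gamma> stationary_iff_euler_lagrange by blast
qed

end
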